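(* Let $\ell\ge1$ and $n\in\mathbb R^D$. For $x,y$ with $n\cdot(x-y)\neq0$ the following Christoffel–Darboux formula holds: $$K^{(\ell)}(x,y)=\frac{\big((n\cdot\Lambda)_{[\ell-1],[\ell]}P_{[\ell]}(x)\big)^\top H_{[\ell-1]}^{-1}P_{[\ell-1]}(y)-P_{[\ell-1]}(x)^\top H_{[\ell-1]}^{-1}(n\cdot\Lambda)_{[\ell-1],[\ell]}P_{[\ell]}(y)}{n\cdot(x-y)},$$ while for the second kind kernel $$\begin{aligned}Q^{(\ell)}(x,y)=&\frac{\big((n\cdot\Lambda)_{[\ell-1],[\ell]}C_{[\ell]}(x)\big)^\top H_{[\ell-1]}^{-1}C_{[\ell-1]}(y)-C_{[\ell-1]}(x)^\top H_{[\ell-1]}^{-1}(n\cdot\Lambda)_{[\ell-1],[\ell]}C_{[\ell]}(y)}{n\cdot(x-y)}\\&+\frac{\big(n\cdot\widehat C^{[\ell]}(x)\big)^\top\big(H^{[\ell]}\big)^{-1}C^{[\ell]}(y)-C^{[\ell]}(x)^\top\big(H^{[\ell]}\big)^{-1}\,n\cdot\widehat C^{[\ell]}(y)}{n\cdot(x-y)}.\end{aligned}$$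
   Context: Let $D\ge 1$ and let $\mu$ be a Borel measure on $\Omega\subseteq\mathbb R^D$ with finite moments. For $k\in\mathbb Z_+$ let $[k]=\{\alpha\in\mathbb Z_+^D:|\alpha|=k\}$, ordered so that $\alpha>\alpha'$ iff at the first coordinate where they differ the entry of $\alpha$ is smaller. $\chi_{[k]}(x)$ is the column vector of monomials $x^\alpha$, $\alpha\in[k]$, and $\chi$ stacks $\chi_{[0]},\chi_{[1]},\dots$; $\chi^*(x)=\big(\prod_{a}x_a^{-1}\big)\chi(x_1^{-1},\dots,x_D^{-1})$. Semi-infinite matrices (vectors) are partitioned in blocks $A_{[k],[\ell]}\in\mathbb R^{|[k]|\times|[\ell]|}$ ($v_{[k]}$); the superscript $[\ell]$ denotes truncation to the block indices $0,\dots,\ell-1$. The moment matrix is $G=\int_\Omega\chi\,d\mu\,\chi^\top$. Standing assumption: $\det G^{[\ell]}\ne0$ for all $\ell$, so that $G=S^{-1}H(S^{-1})^\top$ with $S$ block lower triangular with identity diagonal blocks and $H=\operatorname{diag}(H_{[0]},H_{[1]},\dots)$. The orthogonal polynomials are $P=S\chi$. Shift matrices: $\Lambda_a$, $a=1,\dots,D$, has as only nonzero blocks $(\Lambda_a)_{[k],[k+1]}$, with entries $\delta_{\alpha+e_a,\alpha'}$ for $\alpha\in[k]$, $\alpha'\in[k+1]$ ($e_a$ canonical basis vectors); $n\cdot\Lambda=\sum_an_a\Lambda_a$. Second kind functions: $C=H(S^{-1})^\top\chi^*$ (Laurent series, evaluated at points of their domain of convergence), and $\widehat C_a=\lim_{x_a\to\infty}(x_aC)$,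 $n\cdot\widehat C=\sum_{a=1}^Dn_a\widehat C_a$ (so $\widehat C_a$ does not depend on $x_a$). Kernels: $K^{(\ell)}(x,y)=\sum_{k=0}^{\ell-1}P_{[k]}(x)^\top H_{[k]}^{-1}P_{[k]}(y)$ and $Q^{(\ell)}(x,y)=\sum_{k=0}^{\ell-1}C_{[k]}(x)^\top H_{[k]}^{-1}C_{[k]}(y)$. *)

theory Defs
  imports
    "HOL-Analysis.Analysis"
    "Jordan_Normal_Form.Determinant"
    "Jordan_Normal_Form.Gauss_Jordan_Elimination"
begin

no_notation Matrix.vec_index (infixl "$" 100)
hide_const (open) Determinants.det Finite_Cartesian_Product.mat Finite_Cartesian_Product.vec

section \<open>Multi-indices and monomials\<close>

text \<open>
  The coordinates are indexed by a finite linearly ordered type \<open>'d\<close>, so that the dimension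
  is \<open>D = CARD('d) \<ge> 1\<close>. Points have coordinates in a complete real normed field, so
  that both real and complex points are covered.
\<close>

type_synonym 'd mindex = "'d \<Rightarrow> nat"

definition mdegree :: "'d::finite mindex \<Rightarrow> nat" where
  "mdegree \<alpha> = (\<Sum>a\<in>UNIV. \<alpha> a)"

definition mindex_less :: "'d::{finite,linorder} mindex \<Rightarrow> 'd mindex \<Rightarrow> bool" where
  "mindex_less \<alpha>' \<alpha> \<longleftrightarrow> (\<exists>a. \<alpha> a < \<alpha>' a \<and> (\<forall>b<a. \<alpha> b = \<alpha>' b))"

text \<open>The set \<open>[k]\<close>, listed in increasing order.\<close>

definition mlist :: "nat \<Rightarrow> 'd::{finite,linorder} mindex list" where
  "mlist k = (THE xs. sorted_wrt mindex_less xs \<and> set xs = {\<alpha>. mdegree \<alpha> = k})"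

definition mlist_below :: "nat \<Rightarrow> 'd::{finite,linorder} mindex list" where
  "mlist_below l = concat (map mlist [0..<l])"

definition monomial :: "'a::real_normed_field ^ 'd::finite \<Rightarrow> 'd mindex \<Rightarrow> 'a" where
  "monomial x \<alpha> = (\<Prod>a\<in>UNIV. x $ a ^ \<alpha> a)"

definition monomial_star :: "'a::real_normed_field ^ 'd::finite \<Rightarrow> 'd mindex \<Rightarrow> 'a" where
  "monomial_star x \<alpha> =
     (\<Prod>a\<in>UNIV. inverse (x $ a)) * monomial (\<chi> a. inverse (x $ a)) \<alpha>"


section \<open>Semi-infinite matrices and their blocks\<close>

text \<open>
  Semi-infinite matrices and vectors are indexed by multi-indices. Products are written with
  \<^const>\<open>infsum\<close>; in all matrix products used below, and in \<open>S \<chi>\<close>, only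
  finitely many terms of each sum are nonzero.
\<close>

type_synonym 'd smat = "'d mindex \<Rightarrow> 'd mindex \<Rightarrow> real"
type_synonym ('d, 'a) svec = "'d mindex \<Rightarrow> 'a"

definition smat_mult :: "'d smat \<Rightarrow> 'd smat \<Rightarrow> 'd smat" where
  "smat_mult A B = (\<lambda>\<alpha> \<gamma>. \<Sum>\<^sub>\<infinity>\<beta>. A \<alpha> \<beta> * B \<beta> \<gamma>)"

definition smat_vec ::
    "'d smat \<Rightarrow> ('d, 'a::{real_normed_field,banach}) svec \<Rightarrow> ('d, 'a) svec" where
  "smat_vec A v = (\<lambda>\<alpha>. \<Sum>\<^sub>\<infinity>\<beta>. of_real (A \<alpha> \<beta>) * v \<beta>)"

definition smat_one :: "'d smat" where
  "smat_one = (\<lambda>\<alpha> \<beta>. if \<alpha> = \<beta> then 1 else 0)"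

definition smat_transpose :: "'d smat \<Rightarrow> 'd smat" where
  "smat_transpose A = (\<lambda>\<alpha> \<beta>. A \<beta> \<alpha>)"

text \<open>Only applied to block lower unitriangular matrices, for which the inverse exists uniquely.\<close>

definition smat_inv :: "'d smat \<Rightarrow> 'd smat" where
  "smat_inv A = (THE B. smat_mult A B = smat_one \<and> smat_mult B A = smat_one)"

definition submat :: "'d smat \<Rightarrow> 'd mindex list \<Rightarrow> 'd mindex list \<Rightarrow> real mat" where
  "submat A us vs = Matrix.mat (length us) (length vs) (\<lambda>(i, j). A (us ! i) (vs ! j))"

definition subvec :: "('d, 'a) svec \<Rightarrow> 'd mindex list \<Rightarrow> 'a Matrix.vec" where
  "subvec v us = Matrix.vec (length us) (\<lambda>i. v (us ! i))"

text \<open>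
  \<open>mblock A k l\<close> is the block of \<open>A\<close> at \<open>[k], [l]\<close>; \<open>mtrunc A l\<close> is the
  truncation to the block indices \<open>0, ..., l - 1\<close>.
\<close>

definition mblock :: "'d::{finite,linorder} smat \<Rightarrow> nat \<Rightarrow> nat \<Rightarrow> real mat" where
  "mblock A k l = submat A (mlist k) (mlist l)"

definition vblock :: "('d::{finite,linorder}, 'a) svec \<Rightarrow> nat \<Rightarrow> 'a Matrix.vec" where
  "vblock v k = subvec v (mlist k)"

definition mtrunc :: "'d::{finite,linorder} smat \<Rightarrow> nat \<Rightarrow> real mat" where
  "mtrunc A l = submat A (mlist_below l) (mlist_below l)"

definition vtrunc :: "('d::{finite,linorder}, 'a) svec \<Rightarrow> nat \<Rightarrow> 'a Matrix.vec" where
  "vtrunc v l = subvec v (mlist_below l)"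

definition minv :: "real mat \<Rightarrow> real mat" where
  "minv A = the (mat_inverse A)"

definition mapply :: "real mat \<Rightarrow> 'a::real_normed_field Matrix.vec \<Rightarrow> 'a Matrix.vec" where
  "mapply A v = map_mat of_real A *\<^sub>v v"

definition block_lower_unitriangular :: "'d::finite smat \<Rightarrow> bool" where
  "block_lower_unitriangular S \<longleftrightarrow>
     (\<forall>\<alpha> \<beta>. mdegree \<alpha> < mdegree \<beta> \<longrightarrow> S \<alpha> \<beta> = 0) \<and>
     (\<forall>\<alpha> \<beta>. mdegree \<alpha> = mdegree \<beta> \<longrightarrow> S \<alpha> \<beta> = smat_one \<alpha> \<beta>)"

definition block_diagonal :: "'d::finite smat \<Rightarrow> bool" where
  "block_diagonal H \<longleftrightarrow> (\<forall>\<alpha> \<beta>. mdegree \<alpha> \<noteq> mdegree \<beta> \<longrightarrow> H \<alpha> \<beta> = 0)"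


section \<open>Moment matrix, factorization and shift matrices\<close>

definition finite_moments :: "(real ^ 'd::finite) measure \<Rightarrow> bool" where
  "finite_moments \<mu> \<longleftrightarrow> (\<forall>\<alpha>. integrable \<mu> (\<lambda>x. monomial x \<alpha>))"

definition moment_matrix :: "(real ^ 'd::finite) measure \<Rightarrow> 'd smat" where
  "moment_matrix \<mu> = (\<lambda>\<alpha> \<beta>. \<integral>x. monomial x \<alpha> * monomial x \<beta> \<partial>\<mu>)"

definition block_Cholesky :: "'d::finite smat \<Rightarrow> 'd smat \<Rightarrow> 'd smat \<Rightarrow> bool" where
  "block_Cholesky G S H \<longleftrightarrow>
     block_lower_unitriangular S \<and> block_diagonal H \<and>
     G = smat_mult (smat_mult (smat_inv S) H) (smat_transpose (smat_inv S))"

definition shift_mat :: "'d \<Rightarrow> 'd smat" where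
  "shift_mat a = (\<lambda>\<alpha> \<alpha>'. if \<alpha>(a := Suc (\<alpha> a)) = \<alpha>' then 1 else 0)"

definition dir_shift :: "real ^ 'd::finite \<Rightarrow> 'd smat" where
  "dir_shift n = (\<lambda>\<alpha> \<alpha>'. \<Sum>a\<in>UNIV. n $ a * shift_mat a \<alpha> \<alpha>')"

definition dir_dot :: "real ^ 'd::finite \<Rightarrow> 'a::real_normed_field ^ 'd \<Rightarrow> 'a" where
  "dir_dot n x = (\<Sum>a\<in>UNIV. of_real (n $ a) * x $ a)"


section \<open>Orthogonal polynomials and second kind functions\<close>

definition ortho_poly ::
    "'d::finite smat \<Rightarrow> 'a::{real_normed_field,banach} ^ 'd \<Rightarrow> ('d, 'a) svec" where
  "ortho_poly S x = smat_vec S (monomial x)"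

definition second_kind_coeff :: "'d smat \<Rightarrow> 'd smat \<Rightarrow> 'd smat" where
  "second_kind_coeff S H = smat_mult H (smat_transpose (smat_inv S))"

definition second_kind ::
    "'d::finite smat \<Rightarrow> 'd smat \<Rightarrow> 'a::{real_normed_field,banach} ^ 'd \<Rightarrow> ('d, 'a) svec" where
  "second_kind S H x = smat_vec (second_kind_coeff S H) (monomial_star x)"

text \<open>Points where the Laurent series of the component \<open>C\<^sub>\<alpha>\<close> converges (absolutely).\<close>

definition second_kind_domain ::
    "'d::finite smat \<Rightarrow> 'd smat \<Rightarrow> 'd mindex \<Rightarrow> ('a::{real_normed_field,banach} ^ 'd) set" where
  "second_kind_domain S H \<alpha> =
     {x. (\<forall>a. x $ a \<noteq> 0) \<and>
         (\<lambda>\<beta>. of_real (second_kind_coeff S H \<alpha> \<beta>) * monomial_star x \<beta>) abs_summable_on UNIV}"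

definition set_coord :: "'a ^ 'd::finite \<Rightarrow> 'd \<Rightarrow> 'a \<Rightarrow> 'a ^ 'd" where
  "set_coord x a t = (\<chi> b. if b = a then t else x $ b)"

text \<open>
  For \<open>x\<close> in the domain of \<open>C\<^sub>\<alpha>\<close> the limit exists: replacing a coordinate
  by one of larger norm preserves absolute convergence.
\<close>

definition second_kind_hat ::
    "'d::finite smat \<Rightarrow> 'd smat \<Rightarrow> 'd \<Rightarrow> 'a::{real_normed_field,banach} ^ 'd \<Rightarrow> ('d, 'a) svec" where
  "second_kind_hat S H a x =
     (\<lambda>\<alpha>. Lim at_infinity (\<lambda>t. t * second_kind S H (set_coord x a t) \<alpha>))"

definition dir_second_kind_hat ::
    "'d::finite smat \<Rightarrow> 'd smat \<Rightarrow> real ^ 'd \<Rightarrow> 'a::{real_normed_field,banach} ^ 'd \<Rightarrow> ('d, 'a) svec"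
  where
  "dir_second_kind_hat S H n x =
     (\<lambda>\<alpha>. \<Sum>a\<in>UNIV. of_real (n $ a) * second_kind_hat S H a x \<alpha>)"


section \<open>Christoffel--Darboux kernels\<close>

definition kernel_K ::
    "'d::{finite,linorder} smat \<Rightarrow> 'd smat \<Rightarrow> nat \<Rightarrow>
      'a::{real_normed_field,banach} ^ 'd::{finite,linorder} \<Rightarrow> 'a ^ 'd::{finite,linorder} \<Rightarrow> 'a" where
  "kernel_K S H l x y =
     (\<Sum>k<l. scalar_prod (vblock (ortho_poly S x) k)
               (mapply (minv (mblock H k k)) (vblock (ortho_poly S y) k)))"

definition kernel_Q ::
    "'d::{finite,linorder} smat \<Rightarrow> 'd smat \<Rightarrow> nat \<Rightarrow>
      'a::{real_normed_field,banach} ^ 'd::{finite,linorder} \<Rightarrow> 'a ^ 'd::{finite,linorder} \<Rightarrow> 'a" where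
  "kernel_Q S H l x y =
     (\<Sum>k<l. scalar_prod (vblock (second_kind S H x) k)
               (mapply (minv (mblock H k k)) (vblock (second_kind S H y) k)))"

end

theory Submission
  imports Defs
begin

text \<open>
  Put \<open>J = S (n \<cdot> \<Lambda>) S\<^sup>-\<^sup>1\<close>. The moment matrix \<open>G\<close> depends only on \<open>\<alpha> + \<beta>\<close>, so
  \<open>(n \<cdot> \<Lambda>) G = G (n \<cdot> \<Lambda>)\<^sup>T\<close>. Since \<open>H = S G S\<^sup>T\<close>, this makes \<open>J H\<close> symmetric. The monomials are
  eigenvectors of the shifts, which gives \<open>J P = (n \<cdot> x) P\<close>. The second kind functions are
  \<open>C = S G \<chi>\<^sup>*\<close>, so \<open>J C = S G (n \<cdot> \<Lambda>)\<^sup>T \<chi>\<^sup>*\<close>; here the transposed shift multiplies \<open>\<chi>\<^sup>*\<close> by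
  \<open>x\<^sub>a\<close> but loses the terms with \<open>\<alpha>\<^sub>a = 0\<close>, exactly those that survive in the limit
  \<open>x\<^sub>a \<rightarrow> \<infinity>\<close>. Hence \<open>J C\<close> equals \<open>(n \<cdot> x) C\<close> minus that limit. Both formulas follow by
  moving \<open>J\<close> across the truncated bilinear form with matrix \<open>H\<^sup>-\<^sup>1\<close>. As \<open>J\<close> agrees with
  \<open>n \<cdot> \<Lambda>\<close> above the block diagonal, the only defect comes from the block at \<open>[l - 1], [l]\<close>.
\<close>

section \<open>Multi-indices\<close>

lemma finite_mdegree_le: "finite {\<alpha> :: 'd::finite mindex. mdegree \<alpha> \<le> k}"
proof (rule finite_subset)
  have "\<alpha> a \<le> mdegree \<alpha>" for \<alpha> :: "'d mindex" and a
    unfolding mdegree_def by (rule member_le_sum) auto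
  then show "{\<alpha> :: 'd mindex. mdegree \<alpha> \<le> k} \<subseteq> UNIV \<rightarrow>\<^sub>E {..k}"
    by (fastforce intro: order_trans)
  show "finite (UNIV \<rightarrow>\<^sub>E {..k} :: 'd mindex set)"
    by (rule finite_PiE) auto
qed

lemma finite_mdegree_less: "finite {\<alpha> :: 'd::finite mindex. mdegree \<alpha> < k}"
  and finite_mdegree_eq: "finite {\<alpha> :: 'd::finite mindex. mdegree \<alpha> = k}"
  by (auto intro: finite_subset[OF _ finite_mdegree_le[of k]])

lemma mdegree_Suc: "mdegree (\<alpha>(a := Suc (\<alpha> a))) = Suc (mdegree \<alpha>)"
  by (simp add: mdegree_def sum.remove[of UNIV a])

text \<open>Stated as an instance of \<open>class.linorder\<close> so that the facts on strictly
  sorted enumerations of finite sets can be interpreted for this order; \<open>mlist\<close> is a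
  definite description of such an enumeration.\<close>

lemma mindex_less_linorder:
  "class.linorder (\<lambda>\<alpha> \<beta> :: 'd::{finite,linorder} mindex. \<alpha> = \<beta> \<or> mindex_less \<alpha> \<beta>) mindex_less"
proof
  have irrefl: "\<not> mindex_less \<alpha> \<alpha>" for \<alpha> :: "'d mindex"
    by (simp add: mindex_less_def)
  have trans: "mindex_less \<alpha> \<gamma>"
    if ab: "mindex_less \<alpha> \<beta>" and bc: "mindex_less \<beta> \<gamma>" for \<alpha> \<beta> \<gamma> :: "'d mindex"
  proof -
    obtain a where a: "\<beta> a < \<alpha> a" "\<forall>b<a. \<beta> b = \<alpha> b"
      using ab by (auto simp: mindex_less_def)
    obtain c where c: "\<gamma> c < \<beta> c" "\<forall>b<c. \<gamma> b = \<beta> b"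
      using bc by (auto simp: mindex_less_def)
    \<comment> \<open>The smaller of the two first coordinates of difference decides the comparison
      of \<alpha> with \<gamma>.\<close>
    have "\<gamma> (min a c) < \<alpha> (min a c)"
      by (cases a c rule: linorder_cases) (use a c in auto)
    moreover have "\<forall>b<min a c. \<gamma> b = \<alpha> b"
      using a c by auto
    ultimately show ?thesis
      unfolding mindex_less_def by blast
  qed
  have total: "\<alpha> = \<beta> \<or> mindex_less \<alpha> \<beta> \<or> mindex_less \<beta> \<alpha>" for \<alpha> \<beta> :: "'d mindex"
  proof (cases "\<alpha> = \<beta>")
    case False
    then have ne: "{b. \<alpha> b \<noteq> \<beta> b} \<noteq> {}" by auto
    define a where "a = Min {b. \<alpha> b \<noteq> \<beta> b}"
    have "\<alpha> a \<noteq> \<beta> a"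
      using Min_in[OF _ ne] by (simp add: a_def)
    moreover have "\<forall>b<a. \<alpha> b = \<beta> b"
      using Min_le[of "{b. \<alpha> b \<noteq> \<beta> b}"] by (fastforce simp: a_def)
    ultimately show ?thesis
      unfolding mindex_less_def by (metis linorder_neqE_nat)
  qed simp
  fix \<alpha> \<beta> \<gamma> :: "'d mindex"
  show "mindex_less \<alpha> \<beta> \<longleftrightarrow> (\<alpha> = \<beta> \<or> mindex_less \<alpha> \<beta>) \<and> \<not> (\<beta> = \<alpha> \<or> mindex_less \<beta> \<alpha>)"
    using irrefl trans by blast
  show "\<alpha> = \<alpha> \<or> mindex_less \<alpha> \<alpha>" by simp
  show "\<alpha> = \<gamma> \<or> mindex_less \<alpha> \<gamma>"
    if "\<alpha> = \<beta> \<or> mindex_less \<alpha> \<beta>" "\<beta> = \<gamma> \<or> mindex_less \<beta> \<gamma>"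
    using that trans by blast
  show "\<alpha> = \<beta>" if "\<alpha> = \<beta> \<or> mindex_less \<alpha> \<beta>" "\<beta> = \<alpha> \<or> mindex_less \<beta> \<alpha>"
    using that trans irrefl by blast
  show "(\<alpha> = \<beta> \<or> mindex_less \<alpha> \<beta>) \<or> (\<beta> = \<alpha> \<or> mindex_less \<beta> \<alpha>)"
    using total by blast
qed

text \<open>A finite set has exactly one strictly sorted enumeration, so the definite description in
  \<open>mlist\<close> denotes. The two conclusions turn sums over list positions into sums over a
  degree class.\<close>

lemma mlist_props:
  fixes k :: nat
  defines "xs \<equiv> mlist k :: 'd::{finite,linorder} mindex list"
  shows set_mlist: "set xs = {\<alpha>. mdegree \<alpha> = k}" and distinct_mlist: "distinct xs"
proof -
  interpret ord: linorder "\<lambda>\<alpha> \<beta> :: 'd mindex. \<alpha> = \<beta> \<or> mindex_less \<alpha> \<beta>" mindex_less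
    by (rule mindex_less_linorder)
  let ?P = "\<lambda>xs. sorted_wrt mindex_less xs \<and> set xs = {\<alpha> :: 'd mindex. mdegree \<alpha> = k}"
  have "\<exists>!xs. ?P xs"
    by (rule ord.finite_set_strict_sorted[OF finite_mdegree_eq[of k]])
       (metis ord.strict_sorted_equal)
  then have P: "?P xs"
    unfolding xs_def mlist_def by (rule theI')
  then show "set xs = {\<alpha>. mdegree \<alpha> = k}" by blast
  from P show "distinct xs"
    using ord.strict_sorted_iff by blast
qed

lemma set_mlist_below: "set (mlist_below l) = {\<alpha>. mdegree \<alpha> < l}"
  by (auto simp: mlist_below_def set_mlist)

lemma distinct_mlist_below: "distinct (mlist_below l)"
  by (induction l) (auto simp: mlist_below_def set_mlist distinct_mlist)


section \<open>Row-finite matrices\<close>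

text \<open>The moment matrix can have full rows, so products of semi-infinite matrices need not
  associate. Row-finiteness of suitable factors reduces the entries in question to finite
  sums.\<close>

definition row_finite :: "'d smat \<Rightarrow> bool" where
  "row_finite A \<longleftrightarrow> (\<forall>\<alpha>. finite {\<beta>. A \<alpha> \<beta> \<noteq> 0})"

lemma smat_mult_sum:
  assumes "finite F" "{\<beta>. A \<alpha> \<beta> \<noteq> 0} \<subseteq> F"
  shows "smat_mult A B \<alpha> \<gamma> = (\<Sum>\<beta>\<in>F. A \<alpha> \<beta> * B \<beta> \<gamma>)"
  unfolding smat_mult_def infsum_finite[OF assms(1), symmetric]
  by (rule infsum_cong_neutral) (use assms(2) in auto)

lemma smat_vec_sum:
  assumes "finite F" "{\<beta>. A \<alpha> \<beta> \<noteq> 0} \<subseteq> F"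
  shows "smat_vec A v \<alpha> = (\<Sum>\<beta>\<in>F. of_real (A \<alpha> \<beta>) * v \<beta>)"
  unfolding smat_vec_def infsum_finite[OF assms(1), symmetric]
  by (rule infsum_cong_neutral) (use assms(2) in auto)

lemma smat_transpose_mult:
  "smat_transpose (smat_mult A B) = smat_mult (smat_transpose B) (smat_transpose A)"
  by (simp add: smat_transpose_def smat_mult_def mult.commute)

lemma smat_transpose_transpose [simp]: "smat_transpose (smat_transpose A) = A"
  by (simp add: smat_transpose_def)

lemma smat_mult_one_left: "smat_mult smat_one A = A"
  by (intro ext, subst smat_mult_sum[where F = "{_}"]) (auto simp: smat_one_def)

lemma smat_transpose_one: "smat_transpose smat_one = smat_one"
  by (intro ext) (auto simp: smat_transpose_def smat_one_def)

lemma smat_mult_one_right: "smat_mult A smat_one = A"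
  by (metis smat_mult_one_left smat_transpose_mult smat_transpose_one smat_transpose_transpose)

lemma smat_mult_support:
  "{\<gamma>. smat_mult A B \<alpha> \<gamma> \<noteq> 0} \<subseteq> (\<Union>\<beta>\<in>{\<beta>. A \<alpha> \<beta> \<noteq> 0}. {\<gamma>. B \<beta> \<gamma> \<noteq> 0})"
proof (rule subsetI, rule ccontr)
  fix \<gamma>
  assume "\<gamma> \<notin> (\<Union>\<beta>\<in>{\<beta>. A \<alpha> \<beta> \<noteq> 0}. {\<gamma>. B \<beta> \<gamma> \<noteq> 0})"
  then have "A \<alpha> \<beta> * B \<beta> \<gamma> = 0" for \<beta> by auto
  then have "smat_mult A B \<alpha> \<gamma> = 0"
    unfolding smat_mult_def by (simp only: infsum_0_simp)
  moreover assume "\<gamma> \<in> {\<gamma>. smat_mult A B \<alpha> \<gamma> \<noteq> 0}"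
  ultimately show False by simp
qed

lemma smat_mult_assoc:
  assumes "row_finite A" "row_finite B"
  shows "smat_mult (smat_mult A B) C = smat_mult A (smat_mult B C)"
proof (intro ext)
  fix \<alpha> \<delta>
  define F where "F = {\<beta>. A \<alpha> \<beta> \<noteq> 0}"
  \<comment> \<open>The columns reached from row \<alpha> through \<open>A\<close> and then
    \<open>B\<close>: one finite range that serves both for row \<alpha> of the product and for
    every row of \<open>B\<close> met on the way, so that the two sums can be exchanged.\<close>
  define E where "E = (\<Union>\<beta>\<in>F. {\<gamma>. B \<beta> \<gamma> \<noteq> 0})"
  have F: "finite F" and E: "finite E"
    using assms by (auto simp: F_def E_def row_finite_def)
  have A: "smat_mult A X \<alpha> \<gamma> = (\<Sum>\<beta>\<in>F. A \<alpha> \<beta> * X \<beta> \<gamma>)" for X \<gamma>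
    by (rule smat_mult_sum) (use F in \<open>auto simp: F_def\<close>)
  have sub: "{\<gamma>. smat_mult A B \<alpha> \<gamma> \<noteq> 0} \<subseteq> E"
    using smat_mult_support[of A B \<alpha>] by (simp add: E_def F_def)
  have "smat_mult (smat_mult A B) C \<alpha> \<delta> = (\<Sum>\<gamma>\<in>E. smat_mult A B \<alpha> \<gamma> * C \<gamma> \<delta>)"
    by (rule smat_mult_sum) (fact E, fact sub)
  also have "\<dots> = (\<Sum>\<gamma>\<in>E. (\<Sum>\<beta>\<in>F. A \<alpha> \<beta> * B \<beta> \<gamma>) * C \<gamma> \<delta>)"
    by (simp only: A)
  also have "\<dots> = (\<Sum>\<beta>\<in>F. A \<alpha> \<beta> * (\<Sum>\<gamma>\<in>E. B \<beta> \<gamma> * C \<gamma> \<delta>))"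
    by (simp add: sum_distrib_left sum_distrib_right mult.assoc) (rule sum.swap)
  also have "\<dots> = (\<Sum>\<beta>\<in>F. A \<alpha> \<beta> * smat_mult B C \<beta> \<delta>)"
  proof (rule sum.cong[OF refl])
    fix \<beta> assume "\<beta> \<in> F"
    then have "{\<gamma>. B \<beta> \<gamma> \<noteq> 0} \<subseteq> E"
      by (auto simp: E_def)
    with E have "smat_mult B C \<beta> \<delta> = (\<Sum>\<gamma>\<in>E. B \<beta> \<gamma> * C \<gamma> \<delta>)"
      by (rule smat_mult_sum)
    then show "A \<alpha> \<beta> * (\<Sum>\<gamma>\<in>E. B \<beta> \<gamma> * C \<gamma> \<delta>) = A \<alpha> \<beta> * smat_mult B C \<beta> \<delta>"
      by (simp only:)
  qed
  also have "\<dots> = smat_mult A (smat_mult B C) \<alpha> \<delta>"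
    by (simp only: A)
  finally show "smat_mult (smat_mult A B) C \<alpha> \<delta> = smat_mult A (smat_mult B C) \<alpha> \<delta>" .
qed

lemma row_finite_mult:
  assumes "row_finite A" "row_finite B"
  shows "row_finite (smat_mult A B)"
  unfolding row_finite_def
proof
  fix \<alpha>
  show "finite {\<gamma>. smat_mult A B \<alpha> \<gamma> \<noteq> 0}"
    by (rule finite_subset[OF smat_mult_support]) (use assms in \<open>auto simp: row_finite_def\<close>)
qed

text \<open>The middle factor is arbitrary here: a finite row of \<open>A\<close> and a finite
  column of \<open>C\<close> already make both sides the same finite double sum. This is the form
  needed for \<open>S G S^T\<close> with a full \<open>G\<close>.\<close>

lemma smat_mult_assoc_outer:
  assumes "row_finite A" "row_finite (smat_transpose C)"
  shows "smat_mult (smat_mult A B) C = smat_mult A (smat_mult B C)"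
proof (intro ext)
  fix \<alpha> \<delta>
  define F where "F = {\<beta>. A \<alpha> \<beta> \<noteq> 0}"
  define E where "E = {\<gamma>. C \<gamma> \<delta> \<noteq> 0}"
  have F: "finite F" and E: "finite E"
    using assms by (auto simp: F_def E_def row_finite_def smat_transpose_def)
  have C: "smat_mult X C \<beta> \<delta> = (\<Sum>\<gamma>\<in>E. X \<beta> \<gamma> * C \<gamma> \<delta>)" for X \<beta>
    unfolding smat_mult_def infsum_finite[OF E, symmetric]
    by (rule infsum_cong_neutral) (auto simp: E_def)
  have A: "smat_mult A X \<alpha> \<gamma> = (\<Sum>\<beta>\<in>F. A \<alpha> \<beta> * X \<beta> \<gamma>)" for X \<gamma>
    by (rule smat_mult_sum) (use F in \<open>auto simp: F_def\<close>)
  show "smat_mult (smat_mult A B) C \<alpha> \<delta> = smat_mult A (smat_mult B C) \<alpha> \<delta>"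
    unfolding A C by (simp add: sum_distrib_left sum_distrib_right mult.assoc) (rule sum.swap)
qed

section \<open>Exchange of finite sums with series\<close>

lemma has_sum_finite_sum:
  fixes f :: "'b \<Rightarrow> 'c \<Rightarrow> 'a::topological_comm_monoid_add"
  assumes "finite F" "\<And>b. b \<in> F \<Longrightarrow> (f b has_sum s b) A"
  shows "((\<lambda>c. \<Sum>b\<in>F. f b c) has_sum (\<Sum>b\<in>F. s b)) A"
  using assms by (induction F) (auto intro: has_sum_add)

lemma infsum_finite_sum:
  fixes f :: "'b \<Rightarrow> 'c \<Rightarrow> 'a::{topological_comm_monoid_add,t2_space}"
  assumes "finite F" "\<And>b. b \<in> F \<Longrightarrow> f b summable_on A"
  shows "infsum (\<lambda>c. \<Sum>b\<in>F. f b c) A = (\<Sum>b\<in>F. infsum (f b) A)"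
  by (intro infsumI has_sum_finite_sum has_sum_infsum assms)

text \<open>Rows of \<open>B\<close> may be infinite here, as for the Laurent series of the second
  kind functions. Row \<alpha> of \<open>A\<close> meets only finitely many of them, so a finite sum
  is pulled under convergent series, and only the rows that are met have to converge.\<close>

lemma smat_vec_mult:
  fixes v :: "('d, 'a::{real_normed_field,banach}) svec"
  assumes "row_finite A"
    and "\<And>\<beta>. A \<alpha> \<beta> \<noteq> 0 \<Longrightarrow> (\<lambda>\<gamma>. of_real (B \<beta> \<gamma>) * v \<gamma>) summable_on UNIV"
  shows "smat_vec A (smat_vec B v) \<alpha> = smat_vec (smat_mult A B) v \<alpha>"
proof -
  define F where "F = {\<beta>. A \<alpha> \<beta> \<noteq> 0}"
  have F: "finite F" using assms by (auto simp: F_def row_finite_def)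
  have AB: "smat_mult A B \<alpha> \<gamma> = (\<Sum>\<beta>\<in>F. A \<alpha> \<beta> * B \<beta> \<gamma>)" for \<gamma>
    by (rule smat_mult_sum) (use F in \<open>auto simp: F_def\<close>)
  have "smat_vec A (smat_vec B v) \<alpha> = (\<Sum>\<beta>\<in>F. of_real (A \<alpha> \<beta>) * smat_vec B v \<beta>)"
    by (rule smat_vec_sum) (use F in \<open>auto simp: F_def\<close>)
  also have "\<dots> = (\<Sum>\<beta>\<in>F. \<Sum>\<^sub>\<infinity>\<gamma>. of_real (A \<alpha> \<beta>) * (of_real (B \<beta> \<gamma>) * v \<gamma>))"
    unfolding smat_vec_def by (simp only: infsum_cmult_right')
  also have "\<dots> = (\<Sum>\<^sub>\<infinity>\<gamma>. \<Sum>\<beta>\<in>F. of_real (A \<alpha> \<beta>) * (of_real (B \<beta> \<gamma>) * v \<gamma>))"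
    by (intro infsum_finite_sum[symmetric] summable_on_cmult_right assms(2)) (use F in \<open>auto simp: F_def\<close>)
  also have "\<dots> = smat_vec (smat_mult A B) v \<alpha>"
    by (simp add: smat_vec_def AB sum_distrib_right mult.assoc)
  finally show ?thesis .
qed

lemma row_finite_smat_vec_mult:
  fixes v :: "('d, 'a::{real_normed_field,banach}) svec"
  assumes "row_finite A" "row_finite B"
  shows "smat_vec A (smat_vec B v) = smat_vec (smat_mult A B) v"
proof
  fix \<alpha>
  have "(\<lambda>\<gamma>. of_real (B \<beta> \<gamma>) * v \<gamma>) summable_on UNIV" for \<beta>
    by (rule finite_nonzero_values_imp_summable_on, rule finite_subset[of _ "{\<gamma>. B \<beta> \<gamma> \<noteq> 0}"])
       (use assms(2) in \<open>auto simp: row_finite_def\<close>)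
  then show "smat_vec A (smat_vec B v) \<alpha> = smat_vec (smat_mult A B) v \<alpha>"
    by (intro smat_vec_mult assms(1))
qed


section \<open>Inverses of block lower unitriangular matrices\<close>

lemma block_lower_unitriangular_row_finite:
  fixes S :: "'d::finite smat"
  assumes "block_lower_unitriangular S"
  shows "row_finite S"
  unfolding row_finite_def
proof
  fix \<alpha>
  have "{\<beta>. S \<alpha> \<beta> \<noteq> 0} \<subseteq> {\<beta>. mdegree \<beta> \<le> mdegree \<alpha>}"
    using assms by (auto simp: block_lower_unitriangular_def not_le[symmetric])
  then show "finite {\<beta>. S \<alpha> \<beta> \<noteq> 0}"
    by (rule finite_subset) (rule finite_mdegree_le)
qed

lemma block_diagonal_row_finite:
  fixes H :: "'d::finite smat"
  assumes "block_diagonal H"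
  shows "row_finite H"
  unfolding row_finite_def
proof
  fix \<alpha>
  have "{\<beta>. H \<alpha> \<beta> \<noteq> 0} \<subseteq> {\<beta>. mdegree \<beta> = mdegree \<alpha>}"
    using assms unfolding block_diagonal_def by (metis (mono_tags, lifting) mem_Collect_eq subsetI)
  then show "finite {\<beta>. H \<alpha> \<beta> \<noteq> 0}"
    by (rule finite_subset) (rule finite_mdegree_eq)
qed

text \<open>Forward substitution for \<open>S X = 1\<close>: when the diagonal blocks of
  \<open>S\<close> are identities, row \<alpha> of \<open>X\<close> is determined by the rows of
  lower degree.\<close>

function forward_inv :: "'d::finite smat \<Rightarrow> 'd smat" where
  "forward_inv S \<alpha> \<gamma> =
     smat_one \<alpha> \<gamma> - (\<Sum>\<beta> | mdegree \<beta> < mdegree \<alpha>. S \<alpha> \<beta> * forward_inv S \<beta> \<gamma>)"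
  by auto
termination
  by (relation "Wellfounded.measure (\<lambda>(S, \<alpha>, \<gamma>). mdegree \<alpha>)") auto

declare forward_inv.simps [simp del]

lemma forward_inv_unitriangular:
  "block_lower_unitriangular (forward_inv (S :: 'd::finite smat))"
proof -
  \<comment> \<open>One induction covers both conditions of unitriangularity: for an entry on or
    above the block diagonal, every entry called by the recursion lies strictly above it and
    vanishes.\<close>
  have "mdegree \<alpha> \<le> mdegree \<gamma> \<Longrightarrow> forward_inv S \<alpha> \<gamma> = smat_one \<alpha> \<gamma>" for \<alpha> \<gamma>
  proof (induction "mdegree \<alpha>" arbitrary: \<alpha> rule: less_induct)
    case less
    have "forward_inv S \<beta> \<gamma> = 0" if "mdegree \<beta> < mdegree \<alpha>" for \<beta>
      using less(1)[OF that] less(2) that by (auto simp: smat_one_def)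
    then show ?case
      by (subst forward_inv.simps) simp
  qed
  then show ?thesis
    by (auto simp: block_lower_unitriangular_def smat_one_def)
qed

lemma mult_forward_inv:
  fixes S :: "'d::finite smat"
  assumes "block_lower_unitriangular S"
  shows "smat_mult S (forward_inv S) = smat_one"
proof (intro ext)
  fix \<alpha> \<gamma> :: "'d mindex"
  let ?F = "insert \<alpha> {\<beta>. mdegree \<beta> < mdegree \<alpha>}"
  have "S \<alpha> \<beta> = 0" if "\<beta> \<notin> ?F" for \<beta>
    using that assms
    by (cases "mdegree \<alpha> = mdegree \<beta>") (auto simp: block_lower_unitriangular_def smat_one_def)
  then have "{\<beta>. S \<alpha> \<beta> \<noteq> 0} \<subseteq> ?F" by blast
  then have "smat_mult S (forward_inv S) \<alpha> \<gamma> = (\<Sum>\<beta>\<in>?F. S \<alpha> \<beta> * forward_inv S \<beta> \<gamma>)"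
    by (intro smat_mult_sum) (simp add: finite_mdegree_less)
  also have "\<dots> = S \<alpha> \<alpha> * forward_inv S \<alpha> \<gamma>
      + (\<Sum>\<beta> | mdegree \<beta> < mdegree \<alpha>. S \<alpha> \<beta> * forward_inv S \<beta> \<gamma>)"
    by (rule sum.insert) (auto simp: finite_mdegree_less)
  also have "S \<alpha> \<alpha> = 1"
    using assms by (auto simp: block_lower_unitriangular_def smat_one_def)
  finally show "smat_mult S (forward_inv S) \<alpha> \<gamma> = smat_one \<alpha> \<gamma>"
    by (subst (asm) (2) forward_inv.simps) simp
qed

text \<open>Forward substitution gives only a right inverse \<open>R\<close>. As \<open>R\<close> is
  itself unitriangular, it has a right inverse \<open>R'\<close>, and
  \<open>R' = (S R) R' = S (R R') = S\<close> makes \<open>R\<close> two-sided. Associativity then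
  also yields the uniqueness required by \<open>smat_inv\<close>.\<close>

lemma smat_inv_unitriangular:
  fixes S :: "'d::finite smat"
  assumes S: "block_lower_unitriangular S"
  shows "block_lower_unitriangular (smat_inv S)"
    and "smat_mult S (smat_inv S) = smat_one"
    and "smat_mult (smat_inv S) S = smat_one"
proof -
  define R where "R = forward_inv S"
  define R' where "R' = forward_inv R"
  have R: "block_lower_unitriangular R"
    by (simp add: R_def forward_inv_unitriangular)
  note fin = S[THEN block_lower_unitriangular_row_finite] R[THEN block_lower_unitriangular_row_finite]
  have SR: "smat_mult S R = smat_one" and RR': "smat_mult R R' = smat_one"
    by (simp_all add: R_def R'_def mult_forward_inv S forward_inv_unitriangular)
  have "R' = smat_mult (smat_mult S R) R'"
    by (simp add: SR smat_mult_one_left)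
  also have "\<dots> = S"
    by (simp add: smat_mult_assoc fin RR' smat_mult_one_right)
  finally have RS: "smat_mult R S = smat_one"
    using RR' by simp
  have "smat_inv S = R"
    unfolding smat_inv_def
  proof (rule the_equality)
    fix B assume "smat_mult S B = smat_one \<and> smat_mult B S = smat_one"
    then have "R = smat_mult R (smat_mult S B)"
      by (simp add: smat_mult_one_right)
    then show "B = R"
      by (simp add: smat_mult_assoc[symmetric] fin RS smat_mult_one_left)
  qed (simp add: SR RS)
  then show "block_lower_unitriangular (smat_inv S)"
    "smat_mult S (smat_inv S) = smat_one" "smat_mult (smat_inv S) S = smat_one"
    using R SR RS by simp_all
qed


section \<open>Finite blocks\<close>

lemma sum_nth_distinct:
  assumes "distinct us"
  shows "(\<Sum>i<length us. f (us ! i)) = sum f (set us)"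
  using assms by (simp add: sum_list_distinct_conv_sum_set[symmetric] sum_list_sum_nth atLeast0LessThan)

lemma scalar_prod_subvec:
  "distinct us \<Longrightarrow> scalar_prod (subvec v us) (subvec w us) = (\<Sum>\<alpha>\<in>set us. v \<alpha> * w \<alpha>)"
  by (simp add: scalar_prod_def subvec_def sum_nth_distinct[symmetric] atLeast0LessThan)

lemma mapply_submat:
  assumes "distinct vs"
  shows "mapply (submat A us vs) (subvec v vs) = subvec (\<lambda>\<alpha>. \<Sum>\<beta>\<in>set vs. of_real (A \<alpha> \<beta>) * v \<beta>) us"
  by (rule eq_vecI)
     (simp_all add: mapply_def submat_def subvec_def scalar_prod_def
       sum_nth_distinct[OF assms, symmetric] atLeast0LessThan)

lemma submat_mult:
  assumes "distinct vs"
  shows "submat A us vs * submat B vs ws = submat (\<lambda>\<alpha> \<gamma>. \<Sum>\<beta>\<in>set vs. A \<alpha> \<beta> * B \<beta> \<gamma>) us ws"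
  by (rule eq_matI)
     (simp_all add: submat_def scalar_prod_def sum_nth_distinct[OF assms, symmetric] atLeast0LessThan)

lemma submat_cong:
  assumes "\<And>\<alpha> \<beta>. \<alpha> \<in> set us \<Longrightarrow> \<beta> \<in> set vs \<Longrightarrow> A \<alpha> \<beta> = B \<alpha> \<beta>"
  shows "submat A us vs = submat B us vs"
  by (rule eq_matI) (simp_all add: submat_def assms)

lemma submat_one: "distinct us \<Longrightarrow> submat smat_one us us = 1\<^sub>m (length us)"
  by (rule eq_matI) (auto simp: submat_def smat_one_def nth_eq_iff_index_eq)

section \<open>Inverses of finite submatrices\<close>

lemma minv_eqI:
  assumes A: "A \<in> carrier_mat n n" and B: "B \<in> carrier_mat n n" and BA: "B * A = 1\<^sub>m n"
  shows "minv A = B"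
proof -
  have AB: "A * B = 1\<^sub>m n"
    by (rule mat_mult_left_right_inverse[OF B A BA])
  have "A \<in> Units (ring_mat TYPE(real) n ())"
    using A B AB BA by (auto simp: Units_def ring_mat_def)
  then obtain C where C: "mat_inverse A = Some C"
    using mat_inverse(1)[OF A, of "()"] by (cases "mat_inverse A") auto
  then have "A * C = 1\<^sub>m n" and Cc: "C \<in> carrier_mat n n"
    using mat_inverse(2)[OF A C] by auto
  have "B = B * (A * C)"
    using \<open>A * C = 1\<^sub>m n\<close> B by simp
  also have "\<dots> = C"
    using assoc_mult_mat[OF B A Cc] BA Cc by simp
  finally show ?thesis
    using C by (simp add: minv_def)
qed

text \<open>For finite square matrices a left inverse is also a right inverse. This is carried over
  to entries labelled by multi-indices, and it identifies the Gauss-Jordan result behind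
  \<open>minv\<close>.\<close>

lemma submat_left_inverse:
  assumes us: "distinct us"
    and BA: "\<And>\<alpha> \<gamma>. \<alpha> \<in> set us \<Longrightarrow> \<gamma> \<in> set us \<Longrightarrow> (\<Sum>\<beta>\<in>set us. B \<alpha> \<beta> * A \<beta> \<gamma>) = smat_one \<alpha> \<gamma>"
  shows minv_submat: "minv (submat A us us) = submat B us us"
    and submat_mult_right_inverse:
      "\<And>\<alpha> \<gamma>. \<alpha> \<in> set us \<Longrightarrow> \<gamma> \<in> set us \<Longrightarrow> (\<Sum>\<beta>\<in>set us. A \<alpha> \<beta> * B \<beta> \<gamma>) = smat_one \<alpha> \<gamma>"
proof -
  have carr: "submat X us us \<in> carrier_mat (length us) (length us)" for X :: "'a smat"
    by (simp add: submat_def)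
  have 1: "submat B us us * submat A us us = 1\<^sub>m (length us)"
    unfolding submat_mult[OF us] submat_one[OF us, symmetric] by (rule submat_cong) (rule BA)
  then show "minv (submat A us us) = submat B us us"
    by (rule minv_eqI[OF carr carr])
  have "submat A us us * submat B us us = submat smat_one us us"
    using mat_mult_left_right_inverse[OF carr carr 1] submat_one[OF us] by simp
  then have eq: "submat (\<lambda>\<alpha> \<gamma>. \<Sum>\<beta>\<in>set us. A \<alpha> \<beta> * B \<beta> \<gamma>) us us = submat smat_one us us"
    unfolding submat_mult[OF us] .
  fix \<alpha> \<gamma> assume "\<alpha> \<in> set us" "\<gamma> \<in> set us"
  then obtain i j where "i < length us" "j < length us" "us ! i = \<alpha>" "us ! j = \<gamma>"
    by (auto simp: in_set_conv_nth)
  then show "(\<Sum>\<beta>\<in>set us. A \<alpha> \<beta> * B \<beta> \<gamma>) = smat_one \<alpha> \<gamma>"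
    using arg_cong[OF eq, of "\<lambda>M. M $$ (i, j)"] by (simp add: submat_def)
qed

lemma submat_left_inverse_exists:
  assumes us: "distinct us" and det: "Determinant.det (submat A us us) \<noteq> 0"
  obtains B where "\<And>\<alpha> \<gamma>. \<alpha> \<in> set us \<Longrightarrow> \<gamma> \<in> set us \<Longrightarrow>
    (\<Sum>\<beta>\<in>set us. B \<alpha> \<beta> * A \<beta> \<gamma>) = smat_one \<alpha> \<gamma>"
proof -
  let ?n = "length us"
  have carr: "submat A us us \<in> carrier_mat ?n ?n"
    by (simp add: submat_def)
  obtain X where X: "X \<in> carrier_mat ?n ?n" "X * submat A us us = 1\<^sub>m ?n"
    using det_non_zero_imp_unit[OF carr det, of "()"] by (auto simp: Units_def ring_mat_def)
  \<comment> \<open>Position of a multi-index in the list; it turns the matrix \<open>X\<close> into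
    a function of multi-indices. Outside the list its value is unspecified, and the claim concerns
    entries from the list only.\<close>
  define ix where "ix \<alpha> = (THE i. i < ?n \<and> us ! i = \<alpha>)" for \<alpha>
  have ix: "ix (us ! i) = i" if "i < ?n" for i
    unfolding ix_def by (rule the_equality) (use us that nth_eq_iff_index_eq in auto)
  define B where "B \<alpha> \<beta> = X $$ (ix \<alpha>, ix \<beta>)" for \<alpha> \<beta>
  have "submat B us us = X"
    by (rule eq_matI) (use X ix in \<open>auto simp: submat_def B_def\<close>)
  then have eq: "submat (\<lambda>\<alpha> \<gamma>. \<Sum>\<beta>\<in>set us. B \<alpha> \<beta> * A \<beta> \<gamma>) us us = submat smat_one us us"
    using X submat_mult[OF us, of B us A us] submat_one[OF us] by simp
  have "(\<Sum>\<beta>\<in>set us. B \<alpha> \<beta> * A \<beta> \<gamma>) = smat_one \<alpha> \<gamma>" if "\<alpha> \<in> set us" "\<gamma> \<in> set us" for \<alpha> \<gamma>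
  proof -
    obtain i j where "i < ?n" "j < ?n" "us ! i = \<alpha>" "us ! j = \<gamma>"
      using \<open>\<alpha> \<in> set us\<close> \<open>\<gamma> \<in> set us\<close> by (auto simp: in_set_conv_nth)
    then show ?thesis
      using arg_cong[OF eq, of "\<lambda>M. M $$ (i, j)"] by (simp add: submat_def)
  qed
  then show ?thesis by (rule that)
qed

text \<open>A single \<open>B\<close> has to invert the whole truncation and every diagonal block,
  since the kernels use block inverses while the hat terms use the truncated one. The
  degree-preserving part of any left inverse works, because \<open>H\<close> does not mix
  degrees.\<close>

lemma block_diagonal_inverse:
  fixes H :: "'d::{finite,linorder} smat"
  assumes H: "block_diagonal H" and det: "Determinant.det (mtrunc H l) \<noteq> 0"
  obtains B where "block_diagonal B"
    and "minv (mtrunc H l) = mtrunc B l"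
    and "\<And>k. k < l \<Longrightarrow> minv (mblock H k k) = mblock B k k"
    and "\<And>\<alpha> \<gamma>. mdegree \<alpha> < l \<Longrightarrow> mdegree \<gamma> < l \<Longrightarrow>
      (\<Sum>\<beta> | mdegree \<beta> < l. B \<alpha> \<beta> * H \<beta> \<gamma>) = smat_one \<alpha> \<gamma>"
    and "\<And>\<alpha> \<gamma>. mdegree \<alpha> < l \<Longrightarrow> mdegree \<gamma> < l \<Longrightarrow>
      (\<Sum>\<beta> | mdegree \<beta> < l. H \<alpha> \<beta> * B \<beta> \<gamma>) = smat_one \<alpha> \<gamma>"
proof -
  obtain X where X: "(\<Sum>\<beta> | mdegree \<beta> < l. X \<alpha> \<beta> * H \<beta> \<gamma>) = smat_one \<alpha> \<gamma>"
    if "mdegree \<alpha> < l" "mdegree \<gamma> < l" for \<alpha> \<gamma>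
    using submat_left_inverse_exists[OF distinct_mlist_below det[unfolded mtrunc_def]]
    by (auto simp: set_mlist_below)
  define B where "B \<alpha> \<beta> = (if mdegree \<alpha> = mdegree \<beta> then X \<alpha> \<beta> else 0)" for \<alpha> \<beta>
  have BH: "(\<Sum>\<beta> | mdegree \<beta> < l. B \<alpha> \<beta> * H \<beta> \<gamma>) = smat_one \<alpha> \<gamma>"
    if "mdegree \<alpha> < l" "mdegree \<gamma> < l" for \<alpha> \<gamma>
  proof (cases "mdegree \<alpha> = mdegree \<gamma>")
    case True
    have "B \<alpha> \<beta> * H \<beta> \<gamma> = X \<alpha> \<beta> * H \<beta> \<gamma>" for \<beta>
      using H True by (auto simp: B_def block_diagonal_def)
    then have "(\<Sum>\<beta> | mdegree \<beta> < l. B \<alpha> \<beta> * H \<beta> \<gamma>) = (\<Sum>\<beta> | mdegree \<beta> < l. X \<alpha> \<beta> * H \<beta> \<gamma>)"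
      by (simp only:)
    then show ?thesis by (simp only: X that)
  next
    case False
    have "B \<alpha> \<beta> * H \<beta> \<gamma> = 0" for \<beta>
      using H False unfolding B_def block_diagonal_def by (cases "mdegree \<beta> = mdegree \<gamma>") auto
    then have "(\<Sum>\<beta> | mdegree \<beta> < l. B \<alpha> \<beta> * H \<beta> \<gamma>) = 0"
      by (simp only: sum.neutral_const)
    then show ?thesis using False by (auto simp: smat_one_def)
  qed
  have block: "(\<Sum>\<beta> | mdegree \<beta> = k. B \<alpha> \<beta> * H \<beta> \<gamma>) = smat_one \<alpha> \<gamma>"
    if "k < l" "mdegree \<alpha> = k" "mdegree \<gamma> = k" for k \<alpha> \<gamma>
  proof -
    \<comment> \<open>Row \<alpha> of \<open>B\<close> is supported in degree \<open>k\<close>, so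
      the identity for the truncation restricts to the block.\<close>
    have "(\<Sum>\<beta> | mdegree \<beta> = k. B \<alpha> \<beta> * H \<beta> \<gamma>) = (\<Sum>\<beta> | mdegree \<beta> < l. B \<alpha> \<beta> * H \<beta> \<gamma>)"
      by (rule sum.mono_neutral_left) (use that in \<open>auto simp: B_def finite_mdegree_less\<close>)
    then show ?thesis using BH that by simp
  qed
  show ?thesis
  proof
    show "block_diagonal B" by (simp add: block_diagonal_def B_def)
    show "minv (mtrunc H l) = mtrunc B l"
      unfolding mtrunc_def
      by (rule minv_submat) (use BH in \<open>auto simp: distinct_mlist_below set_mlist_below\<close>)
    show "minv (mblock H k k) = mblock B k k" if "k < l" for k
      unfolding mblock_def
      by (rule minv_submat) (use block that in \<open>auto simp: distinct_mlist set_mlist\<close>)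
    fix \<alpha> \<gamma> :: "'d mindex" assume deg: "mdegree \<alpha> < l" "mdegree \<gamma> < l"
    show "(\<Sum>\<beta> | mdegree \<beta> < l. B \<alpha> \<beta> * H \<beta> \<gamma>) = smat_one \<alpha> \<gamma>"
      by (rule BH[OF deg])
    show "(\<Sum>\<beta> | mdegree \<beta> < l. H \<alpha> \<beta> * B \<beta> \<gamma>) = smat_one \<alpha> \<gamma>"
      using submat_mult_right_inverse[of "mlist_below l" B H \<alpha> \<gamma>] BH deg
      by (simp add: distinct_mlist_below set_mlist_below)
  qed
qed

text \<open>A row of degree below \<open>l\<close> of a block lower triangular \<open>A\<close> only
  meets columns of degree below \<open>l\<close>, so truncating the product loses no terms.\<close>

lemma mtrunc_mult:
  fixes A :: "'d::{finite,linorder} smat"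
  assumes "\<And>\<alpha> \<beta>. mdegree \<alpha> < mdegree \<beta> \<Longrightarrow> A \<alpha> \<beta> = 0"
  shows "mtrunc (smat_mult A B) l = mtrunc A l * mtrunc B l"
proof -
  have "smat_mult A B \<alpha> \<gamma> = (\<Sum>\<beta> | mdegree \<beta> < l. A \<alpha> \<beta> * B \<beta> \<gamma>)" if "mdegree \<alpha> < l" for \<alpha> \<gamma>
  proof (rule smat_mult_sum)
    show "{\<beta>. A \<alpha> \<beta> \<noteq> 0} \<subseteq> {\<beta>. mdegree \<beta> < l}"
    proof (intro subsetI CollectI)
      fix \<beta> assume "\<beta> \<in> {\<beta>. A \<alpha> \<beta> \<noteq> 0}"
      then have "\<not> mdegree \<alpha> < mdegree \<beta>"
        using assms[of \<alpha> \<beta>] by blast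
      then show "mdegree \<beta> < l"
        using that by simp
    qed
  qed (rule finite_mdegree_less)
  then show ?thesis
    unfolding mtrunc_def submat_mult[OF distinct_mlist_below] set_mlist_below
    by (intro submat_cong) (simp add: set_mlist_below)
qed

text \<open>The determinant is taken in the truncated factorization: if it vanished for
  \<open>H\<close>, it would vanish for \<open>G\<close>.\<close>

lemma det_mtrunc_factor:
  fixes G S H :: "'d::{finite,linorder} smat"
  assumes chol: "block_Cholesky G S H" and det: "Determinant.det (mtrunc G l) \<noteq> 0"
  shows "Determinant.det (mtrunc H l) \<noteq> 0"
proof
  assume det0: "Determinant.det (mtrunc H l) = 0"
  let ?R = "smat_inv S" and ?n = "length (mlist_below l :: 'd mindex list)"
  have R: "block_lower_unitriangular ?R" and H: "block_diagonal H"
    and G: "G = smat_mult (smat_mult ?R H) (smat_transpose ?R)"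
    using chol by (auto simp: block_Cholesky_def smat_inv_unitriangular)
  have lower_R: "?R \<alpha> \<beta> = 0" if "mdegree \<alpha> < mdegree \<beta>" for \<alpha> \<beta>
    using R that by (auto simp: block_lower_unitriangular_def)
  \<comment> \<open>The product of the first two factors stays block lower triangular, which allows
    truncation to be distributed over the second product as well.\<close>
  have lower_RH: "smat_mult ?R H \<alpha> \<beta> = 0" if deg: "mdegree \<alpha> < mdegree \<beta>" for \<alpha> \<beta>
  proof -
    have 0: "?R \<alpha> \<gamma> * H \<gamma> \<beta> = 0" for \<gamma>
      using lower_R[of \<alpha> \<gamma>] H deg
      unfolding block_diagonal_def by (cases "mdegree \<gamma> = mdegree \<beta>") auto
    show ?thesis
      unfolding smat_mult_def by (rule infsum_0) (rule 0)
  qed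
  have carr: "mtrunc X l \<in> carrier_mat ?n ?n" for X :: "'d smat"
    by (simp add: mtrunc_def submat_def)
  have "mtrunc G l = mtrunc ?R l * mtrunc H l * mtrunc (smat_transpose ?R) l"
    unfolding G by (simp add: mtrunc_mult lower_R lower_RH)
  then have "Determinant.det (mtrunc G l) = 0"
    by (simp add: det_mult[OF mult_carrier_mat[OF carr carr] carr] det_mult[OF carr carr] det0)
  with det show False by simp
qed


section \<open>Shift matrices and monomials\<close>

lemma monomial_Suc: "monomial x (\<alpha>(a := Suc (\<alpha> a))) = x $ a * monomial x \<alpha>"
  by (simp add: monomial_def prod.remove[of UNIV a] mult_ac)

lemma monomial_star_eq: "monomial_star x \<alpha> = (\<Prod>a\<in>UNIV. inverse (x $ a) ^ Suc (\<alpha> a))"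
  by (simp add: monomial_star_def monomial_def prod.distrib)

lemma monomial_star_Suc:
  assumes "x $ a \<noteq> 0"
  shows "monomial_star x \<alpha> = x $ a * monomial_star x (\<alpha>(a := Suc (\<alpha> a)))"
proof -
  have "(\<Prod>b\<in>UNIV - {a}. inverse (x $ b) ^ Suc ((\<alpha>(a := Suc (\<alpha> a))) b))
      = (\<Prod>b\<in>UNIV - {a}. inverse (x $ b) ^ Suc (\<alpha> b))"
    by (rule prod.cong) auto
  then show ?thesis
    using assms by (simp add: monomial_star_eq prod.remove[of UNIV a] field_simps)
qed

text \<open>The extra factor in \<open>monomial_star\<close> raises the exponent to
  \<open>Suc (\<alpha> a)\<close>, so after multiplication by a nonzero \<open>t\<close> the terms
  with \<open>\<alpha> a = 0\<close> lose their dependence on \<open>t\<close>. At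
  \<open>t = 0\<close> both sides are zero, as \<open>inverse 0 = 0\<close>.\<close>

lemma monomial_star_set_coord:
  fixes x :: "'a::real_normed_field ^ 'd::finite"
  assumes "x $ a \<noteq> 0"
  shows "monomial_star (set_coord x a t) \<alpha> = (x $ a / t) ^ Suc (\<alpha> a) * monomial_star x \<alpha>"
proof -
  have "(\<Prod>b\<in>UNIV - {a}. inverse (set_coord x a t $ b) ^ Suc (\<alpha> b))
      = (\<Prod>b\<in>UNIV - {a}. inverse (x $ b) ^ Suc (\<alpha> b))"
    by (rule prod.cong) (auto simp: set_coord_def)
  then show ?thesis
    using assms
    by (simp add: monomial_star_eq prod.remove[of UNIV a] field_simps set_coord_def power_mult_distrib)
qed

lemma dir_shift_support:
  fixes n :: "real ^ 'd::finite"
  shows "{\<beta>. dir_shift n \<alpha> \<beta> \<noteq> 0} \<subseteq> range (\<lambda>a. \<alpha>(a := Suc (\<alpha> a)))"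
proof (rule subsetI, rule ccontr)
  fix \<beta>
  assume "\<beta> \<notin> range (\<lambda>a. \<alpha>(a := Suc (\<alpha> a)))"
  then have "shift_mat a \<alpha> \<beta> = 0" for a
    by (auto simp: shift_mat_def)
  then have "dir_shift n \<alpha> \<beta> = 0"
    by (simp add: dir_shift_def)
  moreover assume "\<beta> \<in> {\<beta>. dir_shift n \<alpha> \<beta> \<noteq> 0}"
  ultimately show False by simp
qed

lemma row_finite_dir_shift: "row_finite (dir_shift (n :: real ^ 'd::finite))"
  unfolding row_finite_def by (intro allI finite_subset[OF dir_shift_support]) simp

lemma dir_shift_eq_0: "mdegree \<beta> \<noteq> Suc (mdegree \<alpha>) \<Longrightarrow> dir_shift n \<alpha> \<beta> = 0"
  using dir_shift_support[of n \<alpha>] mdegree_Suc by fastforce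

lemma dir_shift_mult:
  fixes n :: "real ^ 'd::finite"
  shows "smat_mult (dir_shift n) A \<alpha> \<beta> = (\<Sum>a\<in>UNIV. n $ a * A (\<alpha>(a := Suc (\<alpha> a))) \<beta>)"
proof -
  let ?F = "range (\<lambda>a. \<alpha>(a := Suc (\<alpha> a)))"
  have "smat_mult (dir_shift n) A \<alpha> \<beta> = (\<Sum>\<gamma>\<in>?F. \<Sum>a\<in>UNIV. n $ a * (shift_mat a \<alpha> \<gamma> * A \<gamma> \<beta>))"
    by (subst smat_mult_sum[OF _ dir_shift_support]) (simp_all add: dir_shift_def sum_distrib_right mult.assoc)
  also have "\<dots> = (\<Sum>a\<in>UNIV. \<Sum>\<gamma>\<in>?F. n $ a * (shift_mat a \<alpha> \<gamma> * A \<gamma> \<beta>))"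
    by (rule sum.swap)
  also have "\<dots> = (\<Sum>a\<in>UNIV. n $ a * A (\<alpha>(a := Suc (\<alpha> a))) \<beta>)"
  proof (rule sum.cong[OF refl])
    fix a
    have "(\<Sum>\<gamma>\<in>?F. n $ a * (shift_mat a \<alpha> \<gamma> * A \<gamma> \<beta>))
        = (\<Sum>\<gamma>\<in>?F. if \<gamma> = \<alpha>(a := Suc (\<alpha> a)) then n $ a * A \<gamma> \<beta> else 0)"
      by (rule sum.cong) (auto simp: shift_mat_def)
    then show "(\<Sum>\<gamma>\<in>?F. n $ a * (shift_mat a \<alpha> \<gamma> * A \<gamma> \<beta>)) = n $ a * A (\<alpha>(a := Suc (\<alpha> a))) \<beta>"
      by simp
  qed
  finally show ?thesis .
qed

lemma mult_dir_shift_transpose: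
  fixes n :: "real ^ 'd::finite"
  shows "smat_mult A (smat_transpose (dir_shift n)) \<alpha> \<beta>
    = (\<Sum>a\<in>UNIV. n $ a * A \<alpha> (\<beta>(a := Suc (\<beta> a))))"
proof -
  have "smat_mult A (smat_transpose (dir_shift n)) \<alpha> \<beta>
      = smat_mult (dir_shift n) (smat_transpose A) \<beta> \<alpha>"
    unfolding smat_mult_def smat_transpose_def by (simp add: mult.commute)
  then show ?thesis
    by (simp add: dir_shift_mult smat_transpose_def)
qed

lemma dir_shift_monomial:
  fixes x :: "'a::{real_normed_field,banach} ^ 'd::finite"
  shows "smat_vec (dir_shift n) (monomial x) = (\<lambda>\<alpha>. dir_dot n x * monomial x \<alpha>)"
proof
  fix \<alpha> :: "'d mindex"
  let ?F = "range (\<lambda>a. \<alpha>(a := Suc (\<alpha> a)))"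
  have "smat_vec (dir_shift n) (monomial x) \<alpha>
      = (\<Sum>\<gamma>\<in>?F. \<Sum>a\<in>UNIV. of_real (n $ a) * (of_real (shift_mat a \<alpha> \<gamma>) * monomial x \<gamma>))"
    by (subst smat_vec_sum[OF _ dir_shift_support]) (simp_all add: dir_shift_def sum_distrib_right mult.assoc)
  also have "\<dots> = (\<Sum>a\<in>UNIV. \<Sum>\<gamma>\<in>?F. of_real (n $ a) * (of_real (shift_mat a \<alpha> \<gamma>) * monomial x \<gamma>))"
    by (rule sum.swap)
  also have "\<dots> = (\<Sum>a\<in>UNIV. of_real (n $ a) * (x $ a * monomial x \<alpha>))"
  proof (rule sum.cong[OF refl])
    fix a
    have "(\<Sum>\<gamma>\<in>?F. of_real (n $ a) * (of_real (shift_mat a \<alpha> \<gamma>) * monomial x \<gamma>))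
        = (\<Sum>\<gamma>\<in>?F. if \<gamma> = \<alpha>(a := Suc (\<alpha> a)) then of_real (n $ a) * monomial x \<gamma> else 0)"
      by (rule sum.cong) (auto simp: shift_mat_def)
    then show "(\<Sum>\<gamma>\<in>?F. of_real (n $ a) * (of_real (shift_mat a \<alpha> \<gamma>) * monomial x \<gamma>))
        = of_real (n $ a) * (x $ a * monomial x \<alpha>)"
      by (simp add: monomial_Suc)
  qed
  also have "\<dots> = dir_dot n x * monomial x \<alpha>"
    by (simp add: dir_dot_def sum_distrib_right mult.assoc)
  finally show "smat_vec (dir_shift n) (monomial x) \<alpha> = dir_dot n x * monomial x \<alpha>" .
qed


section \<open>The Jacobi matrix\<close>

lemma moment_matrix_sym: "smat_transpose (moment_matrix \<mu>) = moment_matrix \<mu>"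
  unfolding smat_transpose_def moment_matrix_def by (simp only: mult.commute)

text \<open>Each entry on either side is the weighted sum over \<open>a\<close> of the integrals of
  \<open>x_a x^(\<alpha> + \<beta>)\<close>: the multivariate Hankel symmetry.\<close>

lemma dir_shift_moment_matrix:
  "smat_mult (dir_shift n) (moment_matrix \<mu>)
    = smat_mult (moment_matrix \<mu>) (smat_transpose (dir_shift n))"
  by (intro ext)
    (simp add: dir_shift_mult mult_dir_shift_transpose moment_matrix_def monomial_Suc mult_ac)

text \<open>For the factor \<open>S\<close> of a moment matrix this is multiplication by
  \<open>dir_dot n x\<close> expressed in the orthogonal polynomials, the multivariate Jacobi
  matrix.\<close>

definition jacobi :: "'d::finite smat \<Rightarrow> real ^ 'd \<Rightarrow> 'd smat" where
  "jacobi S n = smat_mult (smat_mult S (dir_shift n)) (smat_inv S)"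

context
  fixes S :: "'d::finite smat"
  assumes S: "block_lower_unitriangular S"
begin

lemma row_finite_unitriangular: "row_finite S" and row_finite_smat_inv: "row_finite (smat_inv S)"
  using S smat_inv_unitriangular(1)[OF S] by (auto intro: block_lower_unitriangular_row_finite)

lemma row_finite_jacobi: "row_finite (jacobi S n)"
  by (simp add: jacobi_def row_finite_mult row_finite_unitriangular row_finite_smat_inv row_finite_dir_shift)

lemma jacobi_mult: "smat_mult (jacobi S n) S = smat_mult S (dir_shift n)"
  by (simp add: jacobi_def smat_mult_assoc row_finite_mult row_finite_unitriangular row_finite_smat_inv
      row_finite_dir_shift smat_inv_unitriangular(3)[OF S] smat_mult_one_right)

text \<open>A row of \<open>S\<close> stays in degrees at most that of \<alpha>, the shift raises
  the degree by one, and \<open>smat_inv S\<close> cannot raise it again. To land above the degree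
  of \<alpha>, both triangular factors must contribute their identity blocks.\<close>

lemma jacobi_hessenberg:
  assumes "mdegree \<alpha> < mdegree \<gamma>"
  shows "jacobi S n \<alpha> \<gamma> = dir_shift n \<alpha> \<gamma>"
proof -
  let ?R = "smat_inv S"
  have R0: "?R \<alpha> \<beta> = 0" if "mdegree \<alpha> < mdegree \<beta>" for \<alpha> \<beta>
    using smat_inv_unitriangular(1)[OF S] that by (simp add: block_lower_unitriangular_def)
  have R1: "?R \<alpha> \<beta> = smat_one \<alpha> \<beta>" if "mdegree \<alpha> = mdegree \<beta>" for \<alpha> \<beta>
    using smat_inv_unitriangular(1)[OF S] that by (simp add: block_lower_unitriangular_def)
  have LR: "smat_mult (dir_shift n) ?R \<beta> \<gamma> = (if mdegree \<beta> = mdegree \<alpha> then dir_shift n \<beta> \<gamma> else 0)"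
    if le: "mdegree \<beta> \<le> mdegree \<alpha>" for \<beta>
  proof -
    \<comment> \<open>Either \<gamma> has the degree of the raised index, which forces \<beta> into
      the degree of \<alpha> and selects an identity block, or its degree is larger and both sides
      vanish.\<close>
    have "?R (\<beta>(a := Suc (\<beta> a))) \<gamma>
        = (if mdegree \<beta> = mdegree \<alpha> then smat_one (\<beta>(a := Suc (\<beta> a))) \<gamma> else 0)" for a
    proof (cases "mdegree \<gamma> = Suc (mdegree \<beta>)")
      case True
      then show ?thesis
        using assms le by (simp add: R1 mdegree_Suc)
    next
      case False
      then have "mdegree (\<beta>(a := Suc (\<beta> a))) < mdegree \<gamma>"
        using assms le by (simp add: mdegree_Suc)
      then show ?thesis
        using R0 by (auto simp: smat_one_def)
    qed
    then show ?thesis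
      unfolding dir_shift_mult by (simp add: dir_shift_def shift_mat_def smat_one_def)
  qed
  have SF: "{\<beta>. S \<alpha> \<beta> \<noteq> 0} \<subseteq> {\<beta>. mdegree \<beta> \<le> mdegree \<alpha>}"
    using S by (auto simp: block_lower_unitriangular_def not_le[symmetric])
  have "jacobi S n \<alpha> \<gamma>
      = (\<Sum>\<beta> | mdegree \<beta> \<le> mdegree \<alpha>. S \<alpha> \<beta> * smat_mult (dir_shift n) ?R \<beta> \<gamma>)"
    unfolding jacobi_def smat_mult_assoc[OF row_finite_unitriangular row_finite_dir_shift]
    by (rule smat_mult_sum) (rule finite_mdegree_le, rule SF)
  also have "\<dots> = (\<Sum>\<beta> | mdegree \<beta> \<le> mdegree \<alpha>. if \<beta> = \<alpha> then dir_shift n \<beta> \<gamma> else 0)"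
    using S by (intro sum.cong refl)
      (auto simp: LR block_lower_unitriangular_def smat_one_def)
  also have "\<dots> = dir_shift n \<alpha> \<gamma>"
    by (simp add: finite_mdegree_le)
  finally show ?thesis .
qed

lemma jacobi_ortho_poly:
  fixes x :: "'a::{real_normed_field,banach} ^ 'd"
  shows "smat_vec (jacobi S n) (ortho_poly S x) = (\<lambda>\<alpha>. dir_dot n x * ortho_poly S x \<alpha>)"
proof -
  have "smat_vec (jacobi S n) (ortho_poly S x) = smat_vec (smat_mult S (dir_shift n)) (monomial x)"
    unfolding ortho_poly_def
    by (simp add: row_finite_smat_vec_mult row_finite_jacobi row_finite_unitriangular jacobi_mult)
  also have "\<dots> = smat_vec S (\<lambda>\<alpha>. dir_dot n x * monomial x \<alpha>)"
    by (simp add: row_finite_smat_vec_mult[symmetric] row_finite_dir_shift row_finite_unitriangular dir_shift_monomial)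
  also have "\<dots> = (\<lambda>\<alpha>. dir_dot n x * ortho_poly S x \<alpha>)"
    unfolding ortho_poly_def smat_vec_def infsum_cmult_right'[symmetric] by (simp add: mult_ac)
  finally show ?thesis .
qed

end

section \<open>Consequences of the block Cholesky factorization\<close>

context
  fixes S H :: "'d::finite smat" and \<mu> :: "(real ^ 'd) measure"
  assumes chol: "block_Cholesky (moment_matrix \<mu>) S H"
begin

lemma block_Cholesky_parts:
  shows Cholesky_unitriangular: "block_lower_unitriangular S" and Cholesky_block_diagonal: "block_diagonal H"
    and Cholesky_factorization: "moment_matrix \<mu> = smat_mult (smat_mult (smat_inv S) H) (smat_transpose (smat_inv S))"
  using chol by (auto simp: block_Cholesky_def)

lemmas Cholesky_row_finite = row_finite_unitriangular[OF Cholesky_unitriangular] row_finite_smat_inv[OF Cholesky_unitriangular] block_diagonal_row_finite[OF Cholesky_block_diagonal]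
  row_finite_dir_shift row_finite_jacobi[OF Cholesky_unitriangular] row_finite_mult

text \<open>\<open>smat_inv S\<close> is cancelled on the left of the factorization. In this form
  the coefficients inherit the shift symmetry of the moment matrix.\<close>

lemma second_kind_coeff_eq: "second_kind_coeff S H = smat_mult S (moment_matrix \<mu>)"
  by (simp add: second_kind_coeff_def Cholesky_factorization smat_mult_assoc[symmetric] Cholesky_row_finite
      smat_inv_unitriangular(2)[OF Cholesky_unitriangular] smat_mult_one_left)

text \<open>The transposed inverse is cancelled on the right of the factorization. This turns the
  factor \<open>S^-1 H\<close> of \<open>J H\<close> into an expression in the moment
  matrix.\<close>

lemma smat_inv_mult_Cholesky_diagonal: "smat_mult (smat_inv S) H = smat_mult (moment_matrix \<mu>) (smat_transpose S)"
proof -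
  have "smat_mult (smat_transpose (smat_inv S)) (smat_transpose S) = smat_one"
    by (simp add: smat_transpose_mult[symmetric] smat_inv_unitriangular(2)[OF Cholesky_unitriangular] smat_transpose_one)
  then show ?thesis
    by (simp add: Cholesky_factorization smat_mult_assoc_outer Cholesky_row_finite smat_mult_one_right)
qed

lemma Cholesky_diagonal_eq: "H = smat_mult (smat_mult S (moment_matrix \<mu>)) (smat_transpose S)"
proof -
  have "H = smat_mult S (smat_mult (smat_inv S) H)"
    by (simp add: smat_mult_assoc[symmetric] Cholesky_row_finite smat_inv_unitriangular(2)[OF Cholesky_unitriangular]
        smat_mult_one_left)
  then show ?thesis
    by (simp add: smat_inv_mult_Cholesky_diagonal smat_mult_assoc_outer Cholesky_row_finite)
qed

lemma Cholesky_diagonal_sym: "smat_transpose H = H"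
  by (subst (1 2) Cholesky_diagonal_eq)
    (simp add: smat_transpose_mult moment_matrix_sym smat_mult_assoc_outer Cholesky_row_finite)

text \<open>With \<open>L = dir_shift n\<close>, the left side is \<open>S (L G) S^T\<close>. It is
  symmetric because \<open>(L G)^T = G L^T = L G\<close>, and its transpose is the right side since
  \<open>H\<close> is symmetric.\<close>

lemma jacobi_Cholesky_diagonal: "smat_mult (jacobi S n) H = smat_mult H (smat_transpose (jacobi S n))"
proof -
  let ?G = "moment_matrix \<mu>" and ?L = "dir_shift n"
  define K where "K = smat_mult (smat_mult S (smat_mult ?L ?G)) (smat_transpose S)"
  have "smat_mult (jacobi S n) H = smat_mult (smat_mult S ?L) (smat_mult ?G (smat_transpose S))"
    by (simp add: jacobi_def smat_mult_assoc Cholesky_row_finite smat_inv_mult_Cholesky_diagonal)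
  also have "\<dots> = K"
    unfolding K_def by (simp add: smat_mult_assoc smat_mult_assoc_outer Cholesky_row_finite)
  finally have JH: "smat_mult (jacobi S n) H = K" .
  have "smat_transpose K = K"
    unfolding K_def
    by (simp add: smat_transpose_mult moment_matrix_sym dir_shift_moment_matrix
        smat_mult_assoc_outer Cholesky_row_finite)
  moreover have "smat_mult H (smat_transpose (jacobi S n)) = smat_transpose (smat_mult (jacobi S n) H)"
    by (simp add: smat_transpose_mult Cholesky_diagonal_sym)
  ultimately show ?thesis
    by (simp only: JH)
qed

text \<open>With \<open>L = dir_shift n\<close>, \<open>J S G = S L G = S G L^T\<close>. The shift
  ends up next to \<open>monomial_star\<close>, on which it acts by reindexing.\<close>

lemma jacobi_second_kind_coeff:
  "smat_mult (jacobi S n) (second_kind_coeff S H)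
    = smat_mult (second_kind_coeff S H) (smat_transpose (dir_shift n))"
proof -
  have "smat_mult (jacobi S n) (second_kind_coeff S H)
      = smat_mult (smat_mult S (dir_shift n)) (moment_matrix \<mu>)"
    by (simp add: second_kind_coeff_eq smat_mult_assoc[symmetric] Cholesky_row_finite jacobi_mult[OF Cholesky_unitriangular])
  then show ?thesis
    by (simp add: second_kind_coeff_eq smat_mult_assoc Cholesky_row_finite dir_shift_moment_matrix
       smat_mult_assoc_outer)
qed

end


section \<open>Second kind functions\<close>

context
  fixes S H :: "'d::finite smat" and x :: "'a::{real_normed_field,banach} ^ 'd"
    and \<alpha> :: "'d mindex" and f :: "'d mindex \<Rightarrow> 'a"
  assumes dom: "x \<in> second_kind_domain S H \<alpha>"
  defines "f \<equiv> \<lambda>\<beta>. of_real (second_kind_coeff S H \<alpha> \<beta>) * monomial_star x \<beta>"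
begin

lemma second_kind_domain_nonzero: "x $ a \<noteq> 0"
  using dom by (simp add: second_kind_domain_def)

lemma second_kind_term_abs_summable: "f abs_summable_on A"
  using dom unfolding second_kind_domain_def f_def
  by (auto intro: summable_on_subset_banach[where A = UNIV])

lemma second_kind_term_summable: "f summable_on A"
  by (rule abs_summable_summable[OF second_kind_term_abs_summable])

text \<open>With \<open>q = x_a / t\<close>, the term of index \<beta> of the scaled series is
  \<open>x_a q^(\<beta> a) f \<beta>\<close>. Terms with \<open>\<beta> a = 0\<close> are constant,
  and the others together are bounded by a multiple of \<open>norm q\<close>, which tends to
  zero.\<close>

lemma second_kind_hat_eq:
  "second_kind_hat S H a x \<alpha> = x $ a * infsum f {\<beta>. \<beta> a = 0}"
proof -
  let ?c = "x $ a" and ?Z = "{\<beta> :: 'd mindex. \<beta> a = 0}"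
  define M where "M = (\<Sum>\<^sub>\<infinity>\<beta>\<in>-?Z. norm (f \<beta>))"
  have c: "?c \<noteq> 0" by (rule second_kind_domain_nonzero)
  \<comment> \<open>The restriction on \<open>t\<close> gives \<open>norm q \<le> 1\<close>, so the
    original series, up to the factor \<open>x_a\<close>, dominates the scaled one.\<close>
  have bound: "norm (t * second_kind S H (set_coord x a t) \<alpha> - ?c * infsum f ?Z)
      \<le> norm ?c * M * norm (?c * inverse t)"
    if t: "norm t \<ge> norm ?c" for t
  proof -
    define q where "q = ?c * inverse t"
    have t0: "t \<noteq> 0" using t c by auto
    have q: "norm q \<le> 1"
      using t t0 by (simp add: q_def norm_divide divide_inverse[symmetric] divide_le_eq_1)
    define h where "h \<beta> = ?c * q ^ \<beta> a * f \<beta>" for \<beta> :: "'d mindex"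
    have "t * second_kind S H (set_coord x a t) \<alpha> = infsum h UNIV"
      unfolding second_kind_def smat_vec_def infsum_cmult_right'[symmetric]
      using t0
      by (intro infsum_cong)
        (simp add: h_def f_def q_def monomial_star_set_coord[OF c] divide_inverse)
    moreover have hsum: "h abs_summable_on A" for A
    proof (rule Infinite_Sum.abs_summable_on_comparison_test)
      show "(\<lambda>\<beta>. ?c * f \<beta>) abs_summable_on A"
        by (simp add: norm_mult summable_on_cmult_right second_kind_term_abs_summable)
      show "norm (h \<beta>) \<le> norm (?c * f \<beta>)" for \<beta>
        using q by (simp add: h_def norm_mult norm_power mult_right_le_one_le mult_left_le_one_le power_le_one mult_left_mono mult_right_mono)
    qed
    moreover have "infsum h UNIV = infsum h ?Z + infsum h (- ?Z)"
      using infsum_Un_disjoint[OF abs_summable_summable[OF hsum] abs_summable_summable[OF hsum], of ?Z "- ?Z"]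
      by (simp add: Un_commute)
    moreover have "infsum h ?Z = ?c * infsum f ?Z"
      unfolding infsum_cmult_right'[symmetric] by (rule infsum_cong) (simp add: h_def)
    ultimately have "t * second_kind S H (set_coord x a t) \<alpha> - ?c * infsum f ?Z = infsum h (- ?Z)"
      by simp
    moreover have "norm (infsum h (- ?Z)) \<le> (\<Sum>\<^sub>\<infinity>\<beta>\<in>-?Z. norm ?c * norm q * norm (f \<beta>))"
    proof (rule order_trans[OF norm_infsum_bound[OF hsum]], rule infsum_mono)
      show "(\<lambda>\<beta>. norm (h \<beta>)) summable_on (- ?Z)" by (rule hsum)
      show "(\<lambda>\<beta>. norm ?c * norm q * norm (f \<beta>)) summable_on (- ?Z)"
        by (intro summable_on_cmult_right second_kind_term_abs_summable)
      \<comment> \<open>Off \<open>?Z\<close> the exponent is at least one, so one factor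
        \<open>norm q\<close> is kept and the remaining ones are estimated by one.\<close>
      fix \<beta> :: "'d mindex" assume "\<beta> \<in> - ?Z"
      then have "norm q ^ \<beta> a \<le> norm q ^ 1"
        using q by (intro power_decreasing) auto
      then show "norm (h \<beta>) \<le> norm ?c * norm q * norm (f \<beta>)"
        by (simp add: h_def norm_mult norm_power mult_left_mono mult_right_mono)
    qed
    moreover have "(\<Sum>\<^sub>\<infinity>\<beta>\<in>-?Z. norm ?c * norm q * norm (f \<beta>)) = norm ?c * M * norm q"
      unfolding M_def infsum_cmult_right' by (simp only: mult_ac)
    ultimately show ?thesis by (simp add: q_def)
  qed
  have "((\<lambda>t. norm ?c * M * norm (?c * inverse t)) \<longlongrightarrow> norm ?c * M * norm (?c * 0)) at_infinity"
    by (intro tendsto_intros tendsto_inverse_0)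
  then have lim0: "((\<lambda>t. norm ?c * M * norm (?c * inverse t)) \<longlongrightarrow> 0) at_infinity"
    by simp
  have "((\<lambda>t. t * second_kind S H (set_coord x a t) \<alpha> - ?c * infsum f ?Z) \<longlongrightarrow> 0) at_infinity"
    by (rule Lim_null_comparison[OF _ lim0]) (use bound in \<open>auto simp: eventually_at_infinity\<close>)
  then have "((\<lambda>t. t * second_kind S H (set_coord x a t) \<alpha>) \<longlongrightarrow> ?c * infsum f ?Z) at_infinity"
    by (simp add: LIM_zero_iff)
  then show ?thesis
    unfolding second_kind_hat_def by (rule tendsto_Lim[OF trivial_limit_at_infinity])
qed

text \<open>Raising coordinate \<open>a\<close> is a bijection from all multi-indices onto those
  with \<open>\<beta> a \<noteq> 0\<close>. The shifted series is therefore \<open>x_a\<close> times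
  what is left of the full series without its terms at \<open>\<beta> a = 0\<close>, and
  \<open>second_kind_hat\<close> is \<open>x_a\<close> times the sum of the latter.\<close>

lemma second_kind_shifted_term:
  shows second_kind_shifted_term_summable:
      "(\<lambda>\<beta>. of_real (second_kind_coeff S H \<alpha> (\<beta>(a := Suc (\<beta> a)))) * monomial_star x \<beta>) summable_on UNIV"
    and infsum_second_kind_shifted_term:
      "(\<Sum>\<^sub>\<infinity>\<beta>. of_real (second_kind_coeff S H \<alpha> (\<beta>(a := Suc (\<beta> a)))) * monomial_star x \<beta>)
        = x $ a * second_kind S H x \<alpha> - second_kind_hat S H a x \<alpha>"
proof -
  let ?up = "\<lambda>\<beta> :: 'd mindex. \<beta>(a := Suc (\<beta> a))" and ?Z = "{\<beta> :: 'd mindex. \<beta> a = 0}"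
  have eq: "of_real (second_kind_coeff S H \<alpha> (?up \<beta>)) * monomial_star x \<beta> = x $ a * (f \<circ> ?up) \<beta>" for \<beta>
    unfolding monomial_star_Suc[OF second_kind_domain_nonzero, of \<beta> a] f_def comp_def by (rule mult.left_commute)
  have inj: "inj ?up"
  proof (rule injI, rule ext)
    fix \<beta> \<gamma> b assume "?up \<beta> = ?up \<gamma>"
    from fun_cong[OF this, of b] show "\<beta> b = \<gamma> b"
      by (auto split: if_splits)
  qed
  have ran: "range ?up = - ?Z"
  proof
    show "- ?Z \<subseteq> range ?up"
    proof
      fix \<gamma> assume "\<gamma> \<in> - ?Z"
      then have "\<gamma> = ?up (\<gamma>(a := \<gamma> a - 1))" by auto
      then show "\<gamma> \<in> range ?up" by blast
    qed
  qed auto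
  have "(f \<circ> ?up) summable_on UNIV"
    unfolding summable_on_reindex[OF inj, symmetric] by (rule second_kind_term_summable)
  then show "(\<lambda>\<beta>. of_real (second_kind_coeff S H \<alpha> (?up \<beta>)) * monomial_star x \<beta>) summable_on UNIV"
    unfolding eq by (rule summable_on_cmult_right)
  have "second_kind S H x \<alpha> = infsum f ?Z + infsum f (- ?Z)"
    using infsum_Un_disjoint[OF second_kind_term_summable second_kind_term_summable, of ?Z "- ?Z"]
    by (simp add: second_kind_def smat_vec_def f_def[symmetric] Un_commute)
  moreover have "infsum f (- ?Z) = infsum (f \<circ> ?up) UNIV"
    by (simp only: ran[symmetric] infsum_reindex[OF inj])
  ultimately show "(\<Sum>\<^sub>\<infinity>\<beta>. of_real (second_kind_coeff S H \<alpha> (?up \<beta>)) * monomial_star x \<beta>)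
      = x $ a * second_kind S H x \<alpha> - second_kind_hat S H a x \<alpha>"
    unfolding eq infsum_cmult_right' second_kind_hat_eq
    by (simp only: right_diff_distrib[symmetric] add_diff_cancel_left')
qed

end

lemma jacobi_second_kind:
  fixes x :: "'a::{real_normed_field,banach} ^ 'd::finite"
  assumes chol: "block_Cholesky (moment_matrix \<mu>) S H"
    and dom: "\<And>\<gamma>. mdegree \<gamma> \<le> Suc (mdegree \<alpha>) \<Longrightarrow> x \<in> second_kind_domain S H \<gamma>"
  shows "smat_vec (jacobi S n) (second_kind S H x) \<alpha>
    = dir_dot n x * second_kind S H x \<alpha> - dir_second_kind_hat S H n x \<alpha>"
proof -
  let ?T = "second_kind_coeff S H" and ?L = "dir_shift n"
  let ?up = "\<lambda>\<beta> a. \<beta>(a := Suc (\<beta> a)) :: 'd mindex"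
  note S = Cholesky_unitriangular[OF chol]
  have dom_\<alpha>: "x \<in> second_kind_domain S H \<alpha>"
    by (rule dom) simp
  have "smat_vec (jacobi S n) (second_kind S H x) \<alpha>
      = smat_vec (smat_mult (jacobi S n) ?T) (monomial_star x) \<alpha>"
    unfolding second_kind_def
  proof (rule smat_vec_mult[OF row_finite_jacobi[OF S]])
    \<comment> \<open>Row \<alpha> of \<open>J\<close> reaches at most one degree higher, so
      convergence up to degree \<open>Suc (mdegree \<alpha>)\<close> is enough to apply
      \<open>smat_vec_mult\<close>.\<close>
    fix \<gamma> assume "jacobi S n \<alpha> \<gamma> \<noteq> 0"
    then have "mdegree \<gamma> \<le> Suc (mdegree \<alpha>)"
      using jacobi_hessenberg[OF S, of \<alpha> \<gamma> n] dir_shift_eq_0[of \<gamma> \<alpha> n]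
      by (cases "mdegree \<gamma> \<le> mdegree \<alpha>"; cases "mdegree \<gamma> = Suc (mdegree \<alpha>)") auto
    then show "(\<lambda>\<beta>. of_real (?T \<gamma> \<beta>) * monomial_star x \<beta>) summable_on UNIV"
      by (rule second_kind_term_summable[OF dom])
  qed
  also have "\<dots> = (\<Sum>\<^sub>\<infinity>\<beta>. \<Sum>a\<in>UNIV. of_real (n $ a) * (of_real (?T \<alpha> (?up \<beta> a)) * monomial_star x \<beta>))"
    unfolding jacobi_second_kind_coeff[OF chol] smat_vec_def mult_dir_shift_transpose
    by (simp add: sum_distrib_right mult.assoc)
  also have "\<dots> = (\<Sum>a\<in>UNIV. of_real (n $ a)
      * (\<Sum>\<^sub>\<infinity>\<beta>. of_real (?T \<alpha> (?up \<beta> a)) * monomial_star x \<beta>))"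
    unfolding infsum_cmult_right'[symmetric]
    by (intro infsum_finite_sum summable_on_cmult_right second_kind_shifted_term_summable dom_\<alpha>) simp
  also have "\<dots> = (\<Sum>a\<in>UNIV. of_real (n $ a) * (x $ a * second_kind S H x \<alpha> - second_kind_hat S H a x \<alpha>))"
    by (simp only: infsum_second_kind_shifted_term[OF dom_\<alpha>])
  also have "\<dots> = dir_dot n x * second_kind S H x \<alpha> - dir_second_kind_hat S H n x \<alpha>"
    by (simp add: dir_dot_def dir_second_kind_hat_def sum_distrib_right right_diff_distrib
        sum_subtractf mult.assoc)
  finally show ?thesis .
qed


section \<open>The Christoffel--Darboux formula\<close>

text \<open>Multiplying \<open>J H = H J^T\<close> by the inverse \<open>B\<close> on both sides
  gives \<open>B J = J^T B\<close>. This is done inside the truncation, where \<open>B\<close> is an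
  inverse.\<close>

lemma jacobi_inverse_diagonal:
  fixes S H B :: "'d::finite smat"
  assumes chol: "block_Cholesky (moment_matrix \<mu>) S H"
    and BH: "\<And>\<alpha> \<gamma>. mdegree \<alpha> < l \<Longrightarrow> mdegree \<gamma> < l \<Longrightarrow>
      (\<Sum>\<beta> | mdegree \<beta> < l. B \<alpha> \<beta> * H \<beta> \<gamma>) = smat_one \<alpha> \<gamma>"
    and HB: "\<And>\<alpha> \<gamma>. mdegree \<alpha> < l \<Longrightarrow> mdegree \<gamma> < l \<Longrightarrow>
      (\<Sum>\<beta> | mdegree \<beta> < l. H \<alpha> \<beta> * B \<beta> \<gamma>) = smat_one \<alpha> \<gamma>"
    and deg: "mdegree \<delta> < l" "mdegree \<epsilon> < l"
  shows "(\<Sum>\<beta> | mdegree \<beta> < l. B \<delta> \<beta> * jacobi S n \<beta> \<epsilon>)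
    = (\<Sum>\<beta> | mdegree \<beta> < l. jacobi S n \<beta> \<delta> * B \<beta> \<epsilon>)"
proof -
  let ?J = "jacobi S n" and ?U = "{\<beta> :: 'd mindex. mdegree \<beta> < l}"
  have fin: "finite ?U" by (rule finite_mdegree_less)
  have H0: "H \<beta> \<gamma> = 0" if "mdegree \<beta> \<noteq> mdegree \<gamma>" for \<beta> \<gamma>
    using Cholesky_block_diagonal[OF chol] that by (simp add: block_diagonal_def)
  \<comment> \<open>Cutting the sums to the truncation is exact although \<open>J\<close> can leave
    it: a row or column of \<open>H\<close> with index of degree below \<open>l\<close> has no entry
    outside.\<close>
  have JH: "(\<Sum>\<beta>\<in>?U. ?J \<alpha> \<beta> * H \<beta> \<gamma>) = (\<Sum>\<beta>\<in>?U. H \<alpha> \<beta> * ?J \<gamma> \<beta>)"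
    if "mdegree \<alpha> < l" "mdegree \<gamma> < l" for \<alpha> \<gamma>
  proof -
    have "smat_mult ?J H \<alpha> \<gamma> = (\<Sum>\<beta>\<in>?U. ?J \<alpha> \<beta> * H \<beta> \<gamma>)"
      unfolding smat_mult_def infsum_finite[OF fin, symmetric]
      by (rule infsum_cong_neutral) (use that H0 in auto)
    moreover have "smat_mult H (smat_transpose ?J) \<alpha> \<gamma> = (\<Sum>\<beta>\<in>?U. H \<alpha> \<beta> * ?J \<gamma> \<beta>)"
      unfolding smat_mult_def infsum_finite[OF fin, symmetric] smat_transpose_def
      by (rule infsum_cong_neutral) (use that H0 in auto)
    ultimately show ?thesis
      by (simp add: jacobi_Cholesky_diagonal[OF chol])
  qed
  have swap: "(\<Sum>\<gamma>\<in>?U. (\<Sum>\<beta>\<in>?U. f \<beta> * g \<beta> \<gamma>) * h \<gamma>) = (\<Sum>\<beta>\<in>?U. f \<beta> * (\<Sum>\<gamma>\<in>?U. g \<beta> \<gamma> * h \<gamma>))"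
    for f h :: "'d mindex \<Rightarrow> real" and g
    by (simp add: sum_distrib_left sum_distrib_right mult.assoc) (rule sum.swap)
  \<comment> \<open>\<open>H B = 1\<close> is inserted on the right, \<open>J\<close> is moved
    across \<open>H\<close>, and \<open>B H = 1\<close> is removed on the left.\<close>
  have "(\<Sum>\<beta>\<in>?U. B \<delta> \<beta> * ?J \<beta> \<epsilon>) = (\<Sum>\<beta>\<in>?U. B \<delta> \<beta> * (\<Sum>\<gamma>\<in>?U. ?J \<beta> \<gamma> * smat_one \<gamma> \<epsilon>))"
    using deg by (intro sum.cong refl) (simp add: smat_one_def fin mult_delta_right)
  also have "\<dots> = (\<Sum>\<beta>\<in>?U. B \<delta> \<beta> * (\<Sum>\<gamma>\<in>?U. ?J \<beta> \<gamma> * (\<Sum>\<eta>\<in>?U. H \<gamma> \<eta> * B \<eta> \<epsilon>)))"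
    using deg by (intro sum.cong refl arg_cong2[where f = "(*)"] HB[symmetric]) auto
  also have "\<dots> = (\<Sum>\<beta>\<in>?U. B \<delta> \<beta> * (\<Sum>\<eta>\<in>?U. (\<Sum>\<gamma>\<in>?U. ?J \<beta> \<gamma> * H \<gamma> \<eta>) * B \<eta> \<epsilon>))"
    by (simp only: swap)
  also have "\<dots> = (\<Sum>\<beta>\<in>?U. B \<delta> \<beta> * (\<Sum>\<eta>\<in>?U. (\<Sum>\<gamma>\<in>?U. H \<beta> \<gamma> * ?J \<eta> \<gamma>) * B \<eta> \<epsilon>))"
    using deg by (intro sum.cong refl arg_cong2[where f = "(*)"] JH) auto
  also have "\<dots> = (\<Sum>\<eta>\<in>?U. (\<Sum>\<beta>\<in>?U. B \<delta> \<beta> * (\<Sum>\<gamma>\<in>?U. H \<beta> \<gamma> * ?J \<eta> \<gamma>)) * B \<eta> \<epsilon>)"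
    by (simp only: swap)
  also have "\<dots> = (\<Sum>\<eta>\<in>?U. (\<Sum>\<gamma>\<in>?U. (\<Sum>\<beta>\<in>?U. B \<delta> \<beta> * H \<beta> \<gamma>) * ?J \<eta> \<gamma>) * B \<eta> \<epsilon>)"
    by (simp only: swap)
  also have "\<dots> = (\<Sum>\<eta>\<in>?U. (\<Sum>\<gamma>\<in>?U. smat_one \<delta> \<gamma> * ?J \<eta> \<gamma>) * B \<eta> \<epsilon>)"
    using deg by (intro sum.cong refl arg_cong2[where f = "(*)"] BH) auto
  also have "\<dots> = (\<Sum>\<eta>\<in>?U. ?J \<eta> \<delta> * B \<eta> \<epsilon>)"
    using deg by (intro sum.cong refl) (simp add: smat_one_def fin mult_delta_left)
  finally show ?thesis .
qed

text \<open>
  Since \<open>J\<close> is self-adjoint for the form with matrix \<open>B\<close>, the two ways of moving \<open>J\<close> across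
  the truncated form differ only by the entries of \<open>J\<close> that leave the truncation, which form the
  shift block at \<open>[k], [Suc k]\<close>.
\<close>

lemma truncated_christoffel_darboux:
  fixes v w v' w' :: "'d::finite mindex \<Rightarrow> 'a::real_normed_field" and B J L :: "'d smat"
    and k :: nat
  defines "U \<equiv> {\<alpha> :: 'd mindex. mdegree \<alpha> < Suc k}"
  assumes B: "block_diagonal B"
    and J: "\<And>\<alpha> \<gamma>. mdegree \<alpha> < mdegree \<gamma> \<Longrightarrow> J \<alpha> \<gamma> = L \<alpha> \<gamma>"
    and L: "\<And>\<alpha> \<gamma>. mdegree \<gamma> \<noteq> Suc (mdegree \<alpha>) \<Longrightarrow> L \<alpha> \<gamma> = 0"
    and BJ: "\<And>\<alpha> \<gamma>. \<alpha> \<in> U \<Longrightarrow> \<gamma> \<in> U \<Longrightarrow> (\<Sum>\<beta>\<in>U. B \<alpha> \<beta> * J \<beta> \<gamma>) = (\<Sum>\<beta>\<in>U. J \<beta> \<alpha> * B \<beta> \<gamma>)"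
    and v: "\<And>\<alpha>. \<alpha> \<in> U \<Longrightarrow>
      (\<Sum>\<gamma> | mdegree \<gamma> \<le> Suc k. of_real (J \<alpha> \<gamma>) * v \<gamma>) = X * v \<alpha> - v' \<alpha>"
    and w: "\<And>\<alpha>. \<alpha> \<in> U \<Longrightarrow>
      (\<Sum>\<gamma> | mdegree \<gamma> \<le> Suc k. of_real (J \<alpha> \<gamma>) * w \<gamma>) = Y * w \<alpha> - w' \<alpha>"
  shows "(X - Y) * (\<Sum>\<alpha>\<in>U. v \<alpha> * (\<Sum>\<beta>\<in>U. of_real (B \<alpha> \<beta>) * w \<beta>)) =
      (\<Sum>\<alpha> | mdegree \<alpha> = k. (\<Sum>\<gamma> | mdegree \<gamma> = Suc k. of_real (L \<alpha> \<gamma>) * v \<gamma>)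
          * (\<Sum>\<beta> | mdegree \<beta> = k. of_real (B \<alpha> \<beta>) * w \<beta>))
    - (\<Sum>\<alpha> | mdegree \<alpha> = k. v \<alpha> * (\<Sum>\<beta> | mdegree \<beta> = k. of_real (B \<alpha> \<beta>)
          * (\<Sum>\<gamma> | mdegree \<gamma> = Suc k. of_real (L \<beta> \<gamma>) * w \<gamma>)))
    + ((\<Sum>\<alpha>\<in>U. v' \<alpha> * (\<Sum>\<beta>\<in>U. of_real (B \<alpha> \<beta>) * w \<beta>))
      - (\<Sum>\<alpha>\<in>U. v \<alpha> * (\<Sum>\<beta>\<in>U. of_real (B \<alpha> \<beta>) * w' \<beta>)))"
proof -
  define form where "form p q = (\<Sum>\<alpha>\<in>U. p \<alpha> * (\<Sum>\<beta>\<in>U. of_real (B \<alpha> \<beta>) * q \<beta>))"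
    for p q :: "'d mindex \<Rightarrow> 'a"
  \<comment> \<open>The contribution of a row of \<open>J\<close> beyond the truncation; it lies
    above the block diagonal, so its entries are those of \<open>L\<close>.\<close>
  define top where "top u \<alpha> = (\<Sum>\<gamma> | mdegree \<gamma> = Suc k. of_real (L \<alpha> \<gamma>) * u \<gamma>)"
    for u :: "'d mindex \<Rightarrow> 'a" and \<alpha>
  define Ju where "Ju u \<alpha> = (\<Sum>\<gamma>\<in>U. of_real (J \<alpha> \<gamma>) * u \<gamma>)" for u :: "'d mindex \<Rightarrow> 'a" and \<alpha>
  have fin: "finite U" unfolding U_def by (rule finite_mdegree_less)
  have B0: "B \<alpha> \<beta> = 0" if "mdegree \<alpha> \<noteq> mdegree \<beta>" for \<alpha> \<beta>
    using B that by (simp add: block_diagonal_def)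
  \<comment> \<open>Leaving the truncation takes a step from degree \<open>k\<close> to
    \<open>Suc k\<close>, so only the last block contributes.\<close>
  have top0: "top u \<alpha> = 0" if "mdegree \<alpha> \<noteq> k" for u \<alpha>
    using that L by (simp add: top_def)
  have split: "(\<Sum>\<gamma> | mdegree \<gamma> \<le> Suc k. of_real (J \<alpha> \<gamma>) * u \<gamma>) = Ju u \<alpha> + top u \<alpha>"
    if "\<alpha> \<in> U" for u \<alpha>
  proof -
    have "{\<gamma> :: 'd mindex. mdegree \<gamma> \<le> Suc k} = U \<union> {\<gamma>. mdegree \<gamma> = Suc k}"
      by (auto simp: U_def)
    moreover have "(\<Sum>\<gamma> | mdegree \<gamma> = Suc k. of_real (J \<alpha> \<gamma>) * u \<gamma>) = top u \<alpha>"
      unfolding top_def using that by (intro sum.cong refl) (simp add: J U_def)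
    moreover have "(\<Sum>\<gamma>\<in>U \<union> {\<gamma>. mdegree \<gamma> = Suc k}. of_real (J \<alpha> \<gamma>) * u \<gamma>)
        = Ju u \<alpha> + (\<Sum>\<gamma> | mdegree \<gamma> = Suc k. of_real (J \<alpha> \<gamma>) * u \<gamma>)"
      unfolding Ju_def by (rule sum.union_disjoint) (auto simp: fin finite_mdegree_eq, auto simp: U_def)
    ultimately show ?thesis by simp
  qed
  have Jv: "Ju v \<alpha> = X * v \<alpha> - v' \<alpha> - top v \<alpha>" and Jw: "Ju w \<alpha> = Y * w \<alpha> - w' \<alpha> - top w \<alpha>"
    if "\<alpha> \<in> U" for \<alpha>
    using split[OF that, of v] split[OF that, of w] v[OF that] w[OF that]
    by (simp_all add: algebra_simps)
  have swap: "(\<Sum>\<gamma>\<in>U. (\<Sum>\<beta>\<in>U. f \<beta> * g \<beta> \<gamma>) * h \<gamma>) = (\<Sum>\<beta>\<in>U. f \<beta> * (\<Sum>\<gamma>\<in>U. g \<beta> \<gamma> * h \<gamma>))"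
    for f h :: "'d mindex \<Rightarrow> 'a" and g
    by (simp add: sum_distrib_left sum_distrib_right mult.assoc) (rule sum.swap)
  have BJ': "(\<Sum>\<alpha>\<in>U. of_real (J \<alpha> \<gamma>) * of_real (B \<alpha> \<beta>) :: 'a) = (\<Sum>\<alpha>\<in>U. of_real (B \<gamma> \<alpha>) * of_real (J \<alpha> \<beta>))"
    if "\<gamma> \<in> U" "\<beta> \<in> U" for \<gamma> \<beta>
    using arg_cong[OF BJ[OF that], of "of_real :: real \<Rightarrow> 'a"] by simp
  \<comment> \<open>Regrouping brings \<open>J^T B\<close> to the middle of the form, where
    \<open>BJ'\<close> replaces it by \<open>B J\<close>.\<close>
  have "form (Ju v) w = (\<Sum>\<alpha>\<in>U. (\<Sum>\<gamma>\<in>U. v \<gamma> * of_real (J \<alpha> \<gamma>)) * (\<Sum>\<beta>\<in>U. of_real (B \<alpha> \<beta>) * w \<beta>))"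
    by (simp add: form_def Ju_def mult.commute)
  also have "\<dots> = (\<Sum>\<gamma>\<in>U. v \<gamma> * (\<Sum>\<beta>\<in>U. (\<Sum>\<alpha>\<in>U. of_real (J \<alpha> \<gamma>) * of_real (B \<alpha> \<beta>)) * w \<beta>))"
    by (simp only: swap)
  also have "\<dots> = (\<Sum>\<gamma>\<in>U. v \<gamma> * (\<Sum>\<beta>\<in>U. (\<Sum>\<alpha>\<in>U. of_real (B \<gamma> \<alpha>) * of_real (J \<alpha> \<beta>)) * w \<beta>))"
    by (rule sum.cong[OF refl], rule arg_cong2[where f = "(*)", OF refl], rule sum.cong[OF refl],
        rule arg_cong2[where f = "(*)", OF _ refl], rule BJ')
  also have "\<dots> = form v (Ju w)"
    by (simp only: swap form_def Ju_def)
  finally have adj: "form (Ju v) w = form v (Ju w)" .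
  have lin1: "form (\<lambda>\<alpha>. X * v \<alpha> - v' \<alpha> - top v \<alpha>) w = X * form v w - form v' w - form (top v) w"
    by (simp add: form_def left_diff_distrib sum_subtractf sum_distrib_left mult.assoc)
  have lin2: "form v (\<lambda>\<alpha>. Y * w \<alpha> - w' \<alpha> - top w \<alpha>) = Y * form v w - form v w' - form v (top w)"
    by (simp add: form_def right_diff_distrib sum_subtractf sum_distrib_left mult.left_commute)
  have "form (Ju v) w = X * form v w - form v' w - form (top v) w"
    by (subst lin1[symmetric], unfold form_def, rule sum.cong) (simp_all add: Jv)
  moreover have "form v (Ju w) = Y * form v w - form v w' - form v (top w)"
    by (subst lin2[symmetric], unfold form_def, intro sum.cong refl arg_cong2[where f = "(*)"])
      (simp_all add: Jw)
  \<comment> \<open>Equating the two evaluations of the form eliminates the truncated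
    \<open>J\<close> and leaves the boundary terms and the defects.\<close>
  ultimately have main: "(X - Y) * form v w
      = form (top v) w - form v (top w) + (form v' w - form v w')"
    using adj by (simp add: algebra_simps)
  have sub: "{\<alpha> :: 'd mindex. mdegree \<alpha> = k} \<subseteq> U" by (auto simp: U_def)
  have inner: "(\<Sum>\<beta>\<in>U. of_real (B \<alpha> \<beta>) * q \<beta>) = (\<Sum>\<beta> | mdegree \<beta> = k. of_real (B \<alpha> \<beta>) * q \<beta>)"
    if "mdegree \<alpha> = k" for \<alpha> and q :: "'d mindex \<Rightarrow> 'a"
    by (rule sum.mono_neutral_right[OF fin sub]) (use B0 that in auto)
  have "form (top v) w = (\<Sum>\<alpha> | mdegree \<alpha> = k. top v \<alpha> * (\<Sum>\<beta>\<in>U. of_real (B \<alpha> \<beta>) * w \<beta>))"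
    unfolding form_def by (rule sum.mono_neutral_right[OF fin sub]) (simp add: top0)
  also have "\<dots> = (\<Sum>\<alpha> | mdegree \<alpha> = k. top v \<alpha> * (\<Sum>\<beta> | mdegree \<beta> = k. of_real (B \<alpha> \<beta>) * w \<beta>))"
    by (rule sum.cong) (simp_all add: inner)
  finally have top1: "form (top v) w = \<dots>" .
  have "(\<Sum>\<beta>\<in>U. of_real (B \<alpha> \<beta>) * top w \<beta>) = 0" if "mdegree \<alpha> \<noteq> k" for \<alpha>
  proof (rule sum.neutral, rule ballI)
    fix \<beta>
    show "of_real (B \<alpha> \<beta>) * top w \<beta> = 0"
      using that B0[of \<alpha> \<beta>] top0[of \<beta> w] by (cases "mdegree \<beta> = k") auto
  qed
  then have "form v (top w) = (\<Sum>\<alpha> | mdegree \<alpha> = k. v \<alpha> * (\<Sum>\<beta>\<in>U. of_real (B \<alpha> \<beta>) * top w \<beta>))"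
    unfolding form_def by (intro sum.mono_neutral_right[OF fin sub]) simp
  also have "\<dots> = (\<Sum>\<alpha> | mdegree \<alpha> = k. v \<alpha> * (\<Sum>\<beta> | mdegree \<beta> = k. of_real (B \<alpha> \<beta>) * top w \<beta>))"
    by (rule sum.cong) (simp_all add: inner)
  finally have top2: "form v (top w) = \<dots>" .
  show ?thesis
    using main unfolding top1 top2 unfolding form_def top_def .
qed

text \<open>A block diagonal \<open>B\<close> couples only indices of equal degree, so the blockwise
  kernel sum is the full truncated bilinear form, grouped by degree.\<close>

lemma sum_scalar_prod_blocks:
  fixes v w :: "('d::{finite,linorder}, 'a::real_normed_field) svec"
  assumes B: "block_diagonal B"
  shows "(\<Sum>k<l. scalar_prod (vblock v k) (mapply (mblock B k k) (vblock w k)))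
    = (\<Sum>\<alpha> | mdegree \<alpha> < l. v \<alpha> * (\<Sum>\<beta> | mdegree \<beta> < l. of_real (B \<alpha> \<beta>) * w \<beta>))"
proof -
  let ?U = "{\<alpha> :: 'd mindex. mdegree \<alpha> < l}"
  let ?s = "\<lambda>\<alpha>. v \<alpha> * (\<Sum>\<beta>\<in>?U. of_real (B \<alpha> \<beta>) * w \<beta>)"
  have fin: "finite ?U" by (rule finite_mdegree_less)
  have "scalar_prod (vblock v k) (mapply (mblock B k k) (vblock w k)) = sum ?s {\<alpha>. \<alpha> \<in> ?U \<and> mdegree \<alpha> = k}"
    if "k < l" for k
  proof -
    have inner: "(\<Sum>\<beta> | mdegree \<beta> = k. of_real (B \<alpha> \<beta>) * w \<beta>) = (\<Sum>\<beta>\<in>?U. of_real (B \<alpha> \<beta>) * w \<beta>)"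
      if "mdegree \<alpha> = k" for \<alpha>
      by (rule sum.mono_neutral_left[OF fin])
        (use B \<open>mdegree \<alpha> = k\<close> \<open>k < l\<close> in \<open>auto simp: block_diagonal_def\<close>)
    have "scalar_prod (vblock v k) (mapply (mblock B k k) (vblock w k))
        = (\<Sum>\<alpha> | mdegree \<alpha> = k. v \<alpha> * (\<Sum>\<beta> | mdegree \<beta> = k. of_real (B \<alpha> \<beta>) * w \<beta>))"
      by (simp add: vblock_def mblock_def mapply_submat scalar_prod_subvec distinct_mlist set_mlist)
    also have "\<dots> = sum ?s {\<alpha>. \<alpha> \<in> ?U \<and> mdegree \<alpha> = k}"
      by (rule sum.cong) (use that inner in auto)
    finally show ?thesis .
  qed
  then have "(\<Sum>k<l. scalar_prod (vblock v k) (mapply (mblock B k k) (vblock w k)))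
      = (\<Sum>k<l. sum ?s {\<alpha>. \<alpha> \<in> ?U \<and> mdegree \<alpha> = k})"
    by (intro sum.cong) auto
  also have "\<dots> = sum ?s ?U"
    by (rule sum.group[OF fin]) auto
  finally show ?thesis .
qed

text \<open>Common source of both formulas. \<open>v'\<close> and \<open>w'\<close> measure how far
  \<open>v\<close> and \<open>w\<close> are from being eigenvectors of \<open>J\<close>: zero for
  the polynomials, \<open>dir_second_kind_hat\<close> for the second kind functions.\<close>

lemma block_christoffel_darboux:
  fixes v w v' w' :: "('d::{finite,linorder}, 'a::{real_normed_field,banach}) svec"
    and S H :: "'d smat"
  assumes chol: "block_Cholesky (moment_matrix \<mu>) S H"
    and det: "Determinant.det (mtrunc (moment_matrix \<mu>) (Suc k)) \<noteq> 0"
    and v: "\<And>\<alpha>. mdegree \<alpha> \<le> k \<Longrightarrow> smat_vec (jacobi S n) v \<alpha> = X * v \<alpha> - v' \<alpha>"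
    and w: "\<And>\<alpha>. mdegree \<alpha> \<le> k \<Longrightarrow> smat_vec (jacobi S n) w \<alpha> = Y * w \<alpha> - w' \<alpha>"
    and XY: "X - Y \<noteq> 0"
  shows "(\<Sum>j<Suc k. scalar_prod (vblock v j) (mapply (minv (mblock H j j)) (vblock w j))) =
      (scalar_prod (mapply (mblock (dir_shift n) k (Suc k)) (vblock v (Suc k)))
         (mapply (minv (mblock H k k)) (vblock w k))
       - scalar_prod (vblock v k)
         (mapply (minv (mblock H k k))
           (mapply (mblock (dir_shift n) k (Suc k)) (vblock w (Suc k)))))
      / (X - Y)
      + (scalar_prod (vtrunc v' (Suc k)) (mapply (minv (mtrunc H (Suc k))) (vtrunc w (Suc k)))
         - scalar_prod (vtrunc v (Suc k)) (mapply (minv (mtrunc H (Suc k))) (vtrunc w' (Suc k))))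
        / (X - Y)"
proof -
  note S = Cholesky_unitriangular[OF chol] and L = dir_shift_eq_0
  obtain B where B: "block_diagonal B"
    and trunc: "minv (mtrunc H (Suc k)) = mtrunc B (Suc k)"
    and block: "\<And>j. j < Suc k \<Longrightarrow> minv (mblock H j j) = mblock B j j"
    and BH: "\<And>\<alpha> \<gamma>. mdegree \<alpha> < Suc k \<Longrightarrow> mdegree \<gamma> < Suc k \<Longrightarrow>
      (\<Sum>\<beta> | mdegree \<beta> < Suc k. B \<alpha> \<beta> * H \<beta> \<gamma>) = smat_one \<alpha> \<gamma>"
    and HB: "\<And>\<alpha> \<gamma>. mdegree \<alpha> < Suc k \<Longrightarrow> mdegree \<gamma> < Suc k \<Longrightarrow>
      (\<Sum>\<beta> | mdegree \<beta> < Suc k. H \<alpha> \<beta> * B \<beta> \<gamma>) = smat_one \<alpha> \<gamma>"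
    using block_diagonal_inverse[OF Cholesky_block_diagonal[OF chol] det_mtrunc_factor[OF chol det]] by blast
  \<comment> \<open>The row sum over all multi-indices reduces to degrees up to \<open>Suc k\<close>
    by the block Hessenberg shape of \<open>J\<close>.\<close>
  have row: "smat_vec (jacobi S n) u \<alpha>
      = (\<Sum>\<gamma> | mdegree \<gamma> \<le> Suc k. of_real (jacobi S n \<alpha> \<gamma>) * u \<gamma>)"
    if "mdegree \<alpha> \<le> k" for u :: "('d, 'a) svec" and \<alpha>
  proof (rule smat_vec_sum[OF finite_mdegree_le], rule subsetI, rule CollectI, rule ccontr)
    fix \<gamma> assume "\<gamma> \<in> {\<gamma>. jacobi S n \<alpha> \<gamma> \<noteq> 0}" and "\<not> mdegree \<gamma> \<le> Suc k"
    then show False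
      using that jacobi_hessenberg[OF S, of \<alpha> \<gamma> n] L[of \<gamma> \<alpha> n] by auto
  qed
  have sums: "(X - Y) * (\<Sum>\<alpha> | mdegree \<alpha> < Suc k. v \<alpha> * (\<Sum>\<beta> | mdegree \<beta> < Suc k. of_real (B \<alpha> \<beta>) * w \<beta>)) =
      (\<Sum>\<alpha> | mdegree \<alpha> = k. (\<Sum>\<gamma> | mdegree \<gamma> = Suc k. of_real (dir_shift n \<alpha> \<gamma>) * v \<gamma>)
          * (\<Sum>\<beta> | mdegree \<beta> = k. of_real (B \<alpha> \<beta>) * w \<beta>))
    - (\<Sum>\<alpha> | mdegree \<alpha> = k. v \<alpha> * (\<Sum>\<beta> | mdegree \<beta> = k. of_real (B \<alpha> \<beta>)
          * (\<Sum>\<gamma> | mdegree \<gamma> = Suc k. of_real (dir_shift n \<beta> \<gamma>) * w \<gamma>)))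
    + ((\<Sum>\<alpha> | mdegree \<alpha> < Suc k. v' \<alpha> * (\<Sum>\<beta> | mdegree \<beta> < Suc k. of_real (B \<alpha> \<beta>) * w \<beta>))
      - (\<Sum>\<alpha> | mdegree \<alpha> < Suc k. v \<alpha> * (\<Sum>\<beta> | mdegree \<beta> < Suc k. of_real (B \<alpha> \<beta>) * w' \<beta>)))"
    by (rule truncated_christoffel_darboux[where J = "jacobi S n"])
      (use B jacobi_hessenberg[OF S] L jacobi_inverse_diagonal[OF chol BH HB] row v w in auto)
  have "(\<Sum>j<Suc k. scalar_prod (vblock v j) (mapply (minv (mblock H j j)) (vblock w j)))
      = (\<Sum>\<alpha> | mdegree \<alpha> < Suc k. v \<alpha> * (\<Sum>\<beta> | mdegree \<beta> < Suc k. of_real (B \<alpha> \<beta>) * w \<beta>))"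
    unfolding sum_scalar_prod_blocks[OF B, symmetric] by (rule sum.cong) (simp_all add: block)
  moreover have "scalar_prod (vtrunc p (Suc k)) (mapply (minv (mtrunc H (Suc k))) (vtrunc q (Suc k)))
      = (\<Sum>\<alpha> | mdegree \<alpha> < Suc k. p \<alpha> * (\<Sum>\<beta> | mdegree \<beta> < Suc k. of_real (B \<alpha> \<beta>) * q \<beta>))"
    for p q :: "('d, 'a) svec"
    unfolding trunc unfolding mtrunc_def vtrunc_def mapply_submat[OF distinct_mlist_below]
      scalar_prod_subvec[OF distinct_mlist_below] set_mlist_below ..
  moreover have "scalar_prod (vblock v k)
        (mapply (minv (mblock H k k)) (mapply (mblock (dir_shift n) k (Suc k)) (vblock w (Suc k))))
      = (\<Sum>\<alpha> | mdegree \<alpha> = k. v \<alpha> * (\<Sum>\<beta> | mdegree \<beta> = k. of_real (B \<alpha> \<beta>)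
          * (\<Sum>\<gamma> | mdegree \<gamma> = Suc k. of_real (dir_shift n \<beta> \<gamma>) * w \<gamma>)))"
    unfolding block[OF lessI] unfolding mblock_def vblock_def mapply_submat[OF distinct_mlist]
      scalar_prod_subvec[OF distinct_mlist] set_mlist ..
  moreover have "scalar_prod (mapply (mblock (dir_shift n) k (Suc k)) (vblock v (Suc k)))
        (mapply (minv (mblock H k k)) (vblock w k))
      = (\<Sum>\<alpha> | mdegree \<alpha> = k. (\<Sum>\<gamma> | mdegree \<gamma> = Suc k. of_real (dir_shift n \<alpha> \<gamma>) * v \<gamma>)
          * (\<Sum>\<beta> | mdegree \<beta> = k. of_real (B \<alpha> \<beta>) * w \<beta>))"
    unfolding block[OF lessI] unfolding mblock_def vblock_def mapply_submat[OF distinct_mlist]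
      scalar_prod_subvec[OF distinct_mlist] set_mlist ..
  ultimately show ?thesis
    using sums XY by (simp only: add_divide_distrib[symmetric] eq_divide_eq mult.commute if_True not_False_eq_True)
qed

section \<open>Specialization to polynomials and second kind functions\<close>

lemma minv_carrier:
  assumes "A \<in> carrier_mat n n" "Determinant.det A \<noteq> 0"
  shows "minv A \<in> carrier_mat n n"
proof -
  obtain C where "mat_inverse A = Some C"
    using mat_inverse(1)[OF assms(1), of "()"] det_non_zero_imp_unit[OF assms, of "()"]
    by (cases "mat_inverse A") auto
  then show ?thesis
    using mat_inverse(2)[OF assms(1)] by (simp add: minv_def)
qed

text \<open>Removes the second fraction of the general formula when the eigenvector defects vanish.
  Invertibility fixes the dimensions of \<open>minv (mtrunc H l)\<close>, so that the zero vectors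
  have matching length.\<close>

lemma scalar_prod_vtrunc_zero:
  fixes H :: "'d::{finite,linorder} smat" and u :: "('d, 'a::real_normed_field) svec"
  assumes "Determinant.det (mtrunc H l) \<noteq> 0"
  shows "scalar_prod (vtrunc (\<lambda>_ :: 'd mindex. 0) l) (mapply (minv (mtrunc H l)) (vtrunc u l)) = 0"
    and "scalar_prod (vtrunc u l) (mapply (minv (mtrunc H l)) (vtrunc (\<lambda>_ :: 'd mindex. 0) l)) = 0"
proof -
  let ?n = "length (mlist_below l :: 'd mindex list)"
  have carr: "minv (mtrunc H l) \<in> carrier_mat ?n ?n"
    by (rule minv_carrier[OF _ assms]) (simp add: mtrunc_def submat_def)
  have zero: "vtrunc (\<lambda>_ :: 'd mindex. 0 :: 'a) l = 0\<^sub>v ?n"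
    by (rule eq_vecI) (simp_all add: vtrunc_def subvec_def)
  have u: "vtrunc u l \<in> carrier_vec ?n"
    by (simp add: vtrunc_def subvec_def)
  have "mapply (minv (mtrunc H l)) (0\<^sub>v ?n :: 'a Matrix.vec) = 0\<^sub>v ?n"
    using carr by (auto simp: mapply_def intro!: eq_vecI)
  moreover have "mapply (minv (mtrunc H l)) (vtrunc u l) \<in> carrier_vec ?n"
    using carr u by (auto simp: mapply_def)
  ultimately show "scalar_prod (vtrunc (\<lambda>_ :: 'd mindex. 0) l) (mapply (minv (mtrunc H l)) (vtrunc u l)) = 0"
    "scalar_prod (vtrunc u l) (mapply (minv (mtrunc H l)) (vtrunc (\<lambda>_ :: 'd mindex. 0) l)) = 0"
    using u by (simp_all add: zero)
qed

lemma dir_dot_diff: "dir_dot n (x - y) = dir_dot n x - dir_dot n y"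
  by (simp add: dir_dot_def right_diff_distrib sum_subtractf)

theorem theorem2p8p1:
  fixes \<Omega> :: "(real ^ 'd::{finite,linorder}) set"
    and \<mu> :: "(real ^ 'd::{finite,linorder}) measure"
    and S H :: "'d::{finite,linorder} smat"
    and l :: nat
    and n :: "real ^ 'd::{finite,linorder}"
    and x y :: "'a::{real_normed_field,banach} ^ 'd::{finite,linorder}"
  assumes "sets \<mu> = sets (restrict_space borel \<Omega>)"
    and "finite_moments \<mu>"
    and "\<forall>m. Determinant.det (mtrunc (moment_matrix \<mu>) m) \<noteq> 0"
    and "block_Cholesky (moment_matrix \<mu>) S H"
    and "l \<ge> 1"
    and "dir_dot n (x - y) \<noteq> 0"
  shows "kernel_K S H l x y =
      (scalar_prod (mapply (mblock (dir_shift n) (l - 1) l) (vblock (ortho_poly S x) l))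
         (mapply (minv (mblock H (l - 1) (l - 1))) (vblock (ortho_poly S y) (l - 1)))
       - scalar_prod (vblock (ortho_poly S x) (l - 1))
         (mapply (minv (mblock H (l - 1) (l - 1)))
           (mapply (mblock (dir_shift n) (l - 1) l) (vblock (ortho_poly S y) l))))
      / dir_dot n (x - y)
    \<and>
    ((\<forall>\<alpha>. mdegree \<alpha> \<le> l \<longrightarrow>
         x \<in> second_kind_domain S H \<alpha> \<and> y \<in> second_kind_domain S H \<alpha>) \<longrightarrow>
     kernel_Q S H l x y =
      (scalar_prod (mapply (mblock (dir_shift n) (l - 1) l) (vblock (second_kind S H x) l))
         (mapply (minv (mblock H (l - 1) (l - 1))) (vblock (second_kind S H y) (l - 1)))
       - scalar_prod (vblock (second_kind S H x) (l - 1))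
         (mapply (minv (mblock H (l - 1) (l - 1)))
           (mapply (mblock (dir_shift n) (l - 1) l) (vblock (second_kind S H y) l))))
      / dir_dot n (x - y)
      +
      (scalar_prod (vtrunc (dir_second_kind_hat S H n x) l)
         (mapply (minv (mtrunc H l)) (vtrunc (second_kind S H y) l))
       - scalar_prod (vtrunc (second_kind S H x) l)
         (mapply (minv (mtrunc H l)) (vtrunc (dir_second_kind_hat S H n y) l)))
      / dir_dot n (x - y))"
proof -
  obtain k where l: "l = Suc k"
    using assms(5) by (cases l) auto
  note chol = assms(4)
  have det: "Determinant.det (mtrunc (moment_matrix \<mu>) (Suc k)) \<noteq> 0"
    using assms(3) by blast
  have d: "dir_dot n x - dir_dot n y \<noteq> 0"
    using assms(6) by (simp add: dir_dot_diff)
  note cd = block_christoffel_darboux[OF chol det _ _ d]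
  \<comment> \<open>The subtracted zero gives the equation the shape required by \<open>cd\<close>,
    with zero defect.\<close>
  have jP: "smat_vec (jacobi S n) (ortho_poly S z) \<alpha> = dir_dot n z * ortho_poly S z \<alpha> - 0"
    for z :: "'a ^ 'd::{finite,linorder}" and \<alpha>
    by (simp add: jacobi_ortho_poly[OF Cholesky_unitriangular[OF chol]])
  note K = cd[OF jP jP, unfolded scalar_prod_vtrunc_zero[OF det_mtrunc_factor[OF chol det]]]
  show ?thesis
  proof (intro conjI impI)
    show "kernel_K S H l x y =
      (scalar_prod (mapply (mblock (dir_shift n) (l - 1) l) (vblock (ortho_poly S x) l))
         (mapply (minv (mblock H (l - 1) (l - 1))) (vblock (ortho_poly S y) (l - 1)))
       - scalar_prod (vblock (ortho_poly S x) (l - 1))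
         (mapply (minv (mblock H (l - 1) (l - 1)))
           (mapply (mblock (dir_shift n) (l - 1) l) (vblock (ortho_poly S y) l))))
      / dir_dot n (x - y)"
      using K by (simp only: kernel_K_def l dir_dot_diff diff_Suc_1 diff_self div_0 add_0_right)
  next
    assume dom: "\<forall>\<alpha>. mdegree \<alpha> \<le> l \<longrightarrow>
      x \<in> second_kind_domain S H \<alpha> \<and> y \<in> second_kind_domain S H \<alpha>"
    \<comment> \<open>Rows of \<open>J\<close> up to degree \<open>k\<close> involve second kind
      functions up to degree \<open>Suc k = l\<close>, which is the range of the convergence
      assumption.\<close>
    have jx: "smat_vec (jacobi S n) (second_kind S H x) \<alpha>
        = dir_dot n x * second_kind S H x \<alpha> - dir_second_kind_hat S H n x \<alpha>"
      and jy: "smat_vec (jacobi S n) (second_kind S H y) \<alpha>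
        = dir_dot n y * second_kind S H y \<alpha> - dir_second_kind_hat S H n y \<alpha>"
      if "mdegree \<alpha> \<le> k" for \<alpha>
      using dom that by (auto intro!: jacobi_second_kind[OF chol] simp: l)
    show "kernel_Q S H l x y =
      (scalar_prod (mapply (mblock (dir_shift n) (l - 1) l) (vblock (second_kind S H x) l))
         (mapply (minv (mblock H (l - 1) (l - 1))) (vblock (second_kind S H y) (l - 1)))
       - scalar_prod (vblock (second_kind S H x) (l - 1))
         (mapply (minv (mblock H (l - 1) (l - 1)))
           (mapply (mblock (dir_shift n) (l - 1) l) (vblock (second_kind S H y) l))))
      / dir_dot n (x - y)
      +
      (scalar_prod (vtrunc (dir_second_kind_hat S H n x) l)
         (mapply (minv (mtrunc H l)) (vtrunc (second_kind S H y) l))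
       - scalar_prod (vtrunc (second_kind S H x) l)
         (mapply (minv (mtrunc H l)) (vtrunc (dir_second_kind_hat S H n y) l)))
      / dir_dot n (x - y)"
      using cd[OF jx jy] by (simp only: kernel_Q_def l dir_dot_diff diff_Suc_1)
  qed
qed

end
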